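(* Let $g_1,\dots,g_m\in\mathbb{R}[x]=\mathbb{R}[x_1,\dots,x_n]$, let $V:=\{x\in\mathbb{R}^n : g_j(x)=0,\ j=1,\dots,m\}$, and let $f\in\mathbb{R}[x]$. Assume that $f$ has a global minimizer $x^*\in V$ on $V$, with $f(x^* )=f^*:=\inf_{x\in V}f(x)$. Let $\epsilon>0$ be fixed. Then $$f^*\,\le\,\sup\mathbf{Q}^*_{\epsilon r}\,\le\,\inf\mathbf{Q}_{\epsilon r}\,\le\,f^*+\epsilon\,\theta_r(x^* )\,\le\,f^*+\epsilon\sum_{i=1}^n e^{(x_i^* )^2},$$ provided that $r\in\mathbb{N}$ is sufficiently large.
   Context: For $r\in\mathbb{N}$, $\theta_r(x):=\sum_{k=0}^{r}\sum_{i=1}^n \frac{x_i^{2k}}{k!}$ and $f_{\epsilon r}:=f+\epsilon\theta_r$. Let $2r\ge\max[\deg f,\deg g_1^2,\dots,\deg g_m^2]$. For a real sequence $\mathbf{y}=(y_\alpha)$ indexed by $\alpha\in\mathbb{N}^n$, $|\alpha|\le 2r$, let $L_{\mathbf{y}}(p):=\sum_\alpha p_\alpha y_\alpha$ for every polynomial $p=\sum_\alpha p_\alpha x^\alpha$ of degree at most $2r$, and let $M_r(\mathbf{y})$ be the moment matrix: the symmetric matrix with rows and columns indexed by $\alpha,\beta\in\mathbb{N}^n$ with $|\alpha|,|\beta|\le r$ and with entry $y_{\alpha+\beta}$ at position $(\alpha,\beta)$. $A\succeq 0$ means that $A$ is positive semidefinite. $\mathbf{Q}_{\epsilon r}$ is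 the problem of minimizing $L_{\mathbf{y}}(f_{\epsilon r})$ over all such $\mathbf{y}$ subject to $M_r(\mathbf{y})\succeq 0$, $L_{\mathbf{y}}(g_j^2)\le 0$ for $j=1,\dots,m$, and $y_0=1$; its optimal value (infimum) is $\inf\mathbf{Q}_{\epsilon r}$. $\mathbf{Q}^*_{\epsilon r}$ is the problem of maximizing $\gamma$ over all $(\lambda,\gamma,q)$ with $\lambda\in\mathbb{R}^m$, $\lambda\ge 0$, $\gamma\in\mathbb{R}$, and $q\in\mathbb{R}[x]$ a sum of squares of degree at most $2r$, subject to $f_{\epsilon r}-\gamma=q-\sum_{j=1}^m\lambda_j g_j^2$; its optimal value (supremum) is $\sup\mathbf{Q}^*_{\epsilon r}$. *)

theory Defs
  imports "HOL-Analysis.Analysis" "HOL-Library.Poly_Mapping"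
begin

text \<open>
  Elements of \<open>\<real>[x\<^sub>1, \<dots>, x\<^sub>n]\<close> are finitely supported maps from exponents to coefficients,
  the variables being indexed by a finite type \<open>'n\<close>; the ring structure is the convolution
  product of \<open>Poly_Mapping\<close>.
\<close>

type_synonym 'n expo = "'n \<Rightarrow>\<^sub>0 nat"
type_synonym 'n rpoly = "'n expo \<Rightarrow>\<^sub>0 real"

definition abs_expo :: "'n::finite expo \<Rightarrow> nat"  (* |\<alpha>| *)
  where "abs_expo \<alpha> = (\<Sum>i\<in>UNIV. Poly_Mapping.lookup \<alpha> i)"

definition expos :: "nat \<Rightarrow> 'n::finite expo set"
  where "expos d = {\<alpha>. abs_expo \<alpha> \<le> d}"

lemma finite_expos: "finite (expos d :: 'n::finite expo set)"
proof -
  have "Poly_Mapping.lookup ` (expos d :: 'n expo set) \<subseteq> UNIV \<rightarrow>\<^sub>E {..d}"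
  proof (intro image_subsetI PiE_I)
    fix \<alpha> :: "'n expo" and i assume "\<alpha> \<in> expos d"
    then show "Poly_Mapping.lookup \<alpha> i \<in> {..d}"
      using member_le_sum[of i UNIV "Poly_Mapping.lookup \<alpha>"] by (simp add: expos_def abs_expo_def)
  qed auto
  moreover have "finite ((UNIV :: 'n set) \<rightarrow>\<^sub>E {..d})"
    by (intro finite_PiE) auto
  ultimately have "finite (Poly_Mapping.lookup ` (expos d :: 'n expo set))"
    by (rule finite_subset)
  then show ?thesis
    by (rule finite_imageD) (simp add: inj_on_def poly_mapping_eqI)
qed

(* Total degree, with degree 0 for the zero polynomial. *)
definition deg :: "'n::finite rpoly \<Rightarrow> nat"
  where "deg p = Max (insert 0 (abs_expo ` Poly_Mapping.keys p))"

definition eval :: "'n::finite rpoly \<Rightarrow> real ^ 'n \<Rightarrow> real"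
  where "eval p x = (\<Sum>\<alpha>\<in>Poly_Mapping.keys p. Poly_Mapping.lookup p \<alpha> * (\<Prod>i\<in>UNIV. (x $ i) ^ Poly_Mapping.lookup \<alpha> i))"

definition Cst :: "real \<Rightarrow> 'n rpoly"
  where "Cst c = Poly_Mapping.single 0 c"

definition X :: "'n \<Rightarrow> 'n rpoly"
  where "X i = Poly_Mapping.single (Poly_Mapping.single i 1) 1"

definition sos :: "'n rpoly \<Rightarrow> bool"
  where "sos q \<longleftrightarrow> (\<exists>ps. q = (\<Sum>p\<leftarrow>ps. p\<^sup>2))"

definition theta :: "nat \<Rightarrow> 'n::finite rpoly"
  where "theta r = (\<Sum>k=0..r. \<Sum>i\<in>UNIV. Cst (1 / fact k) * X i ^ (2 * k))"

definition perturb :: "'n::finite rpoly \<Rightarrow> real \<Rightarrow> nat \<Rightarrow> 'n rpoly"  (* f_{\<epsilon>r} *)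
  where "perturb f \<epsilon> r = f + Cst \<epsilon> * theta r"

definition zeros :: "nat \<Rightarrow> (nat \<Rightarrow> 'n::finite rpoly) \<Rightarrow> (real ^ 'n) set"
  where "zeros m g = {x. \<forall>j\<in>{1..m}. eval (g j) x = 0}"

text \<open>
  All optimal values are taken in the extended reals, so that infeasible and unbounded
  problems get the usual values.
\<close>

definition fstar :: "'n::finite rpoly \<Rightarrow> nat \<Rightarrow> (nat \<Rightarrow> 'n rpoly) \<Rightarrow> ereal"
  where "fstar f m g = (INF x\<in>zeros m g. ereal (eval f x))"

definition riesz :: "('n expo \<Rightarrow> real) \<Rightarrow> 'n rpoly \<Rightarrow> real"  (* L_y *)
  where "riesz y p = (\<Sum>\<alpha>\<in>Poly_Mapping.keys p. Poly_Mapping.lookup p \<alpha> * y \<alpha>)"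

definition moment_matrix :: "('n expo \<Rightarrow> real) \<Rightarrow> 'n expo \<Rightarrow> 'n expo \<Rightarrow> real"
  where "moment_matrix y \<alpha> \<beta> = y (\<alpha> + \<beta>)"

(* Positive semidefiniteness of the real matrix with rows and columns indexed by the finite set I. *)
definition psd :: "'i set \<Rightarrow> ('i \<Rightarrow> 'i \<Rightarrow> real) \<Rightarrow> bool"
  where "psd I A \<longleftrightarrow> (\<forall>a\<in>I. \<forall>b\<in>I. A a b = A b a) \<and>
    (\<forall>v. 0 \<le> (\<Sum>a\<in>I. \<Sum>b\<in>I. v a * A a b * v b))"

(* Membership in extensional makes y a sequence indexed exactly by the exponents of size \<le> 2r. *)
definition Q_feasible :: "nat \<Rightarrow> (nat \<Rightarrow> 'n::finite rpoly) \<Rightarrow> nat \<Rightarrow> ('n expo \<Rightarrow> real) set"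
  where "Q_feasible m g r =
    {y \<in> extensional (expos (2 * r)).
       psd (expos r) (moment_matrix y) \<and> (\<forall>j\<in>{1..m}. riesz y ((g j)\<^sup>2) \<le> 0) \<and> y 0 = 1}"

definition inf_Q :: "'n::finite rpoly \<Rightarrow> nat \<Rightarrow> (nat \<Rightarrow> 'n rpoly) \<Rightarrow> real \<Rightarrow> nat \<Rightarrow> ereal"
  where "inf_Q f m g \<epsilon> r = (INF y\<in>Q_feasible m g r. ereal (riesz y (perturb f \<epsilon> r)))"

definition Qdual_feasible ::
    "'n::finite rpoly \<Rightarrow> nat \<Rightarrow> (nat \<Rightarrow> 'n rpoly) \<Rightarrow> real \<Rightarrow> nat \<Rightarrow> ((nat \<Rightarrow> real) \<times> real \<times> 'n rpoly) set"
  where "Qdual_feasible f m g \<epsilon> r =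
    {(l, \<gamma>, q). l \<in> {1..m} \<rightarrow>\<^sub>E {0..} \<and> sos q \<and> deg q \<le> 2 * r \<and>
       perturb f \<epsilon> r - Cst \<gamma> = q - (\<Sum>j=1..m. Cst (l j) * (g j)\<^sup>2)}"

definition sup_Qdual :: "'n::finite rpoly \<Rightarrow> nat \<Rightarrow> (nat \<Rightarrow> 'n rpoly) \<Rightarrow> real \<Rightarrow> nat \<Rightarrow> ereal"
  where "sup_Qdual f m g \<epsilon> r = (SUP (l, \<gamma>, q)\<in>Qdual_feasible f m g \<epsilon> r. ereal \<gamma>)"

end

theory Submission
  imports Defs
begin

text \<open>
  Already \<open>\<gamma> = f\<^sup>*\<close> is dual feasible for large \<open>r\<close>, with all multipliers equal. By compactness,
  \<open>p = f - f\<^sup>* + (\<epsilon>/2) \<theta>\<^sub>d + \<lambda> \<Sum>\<^sub>j g\<^sub>j\<^sup>2\<close> is bounded below by a positive constant for suitable \<open>d\<close>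
  and \<open>\<lambda>\<close>: the constant term of \<open>\<theta>\<^sub>d\<close> gives strict positivity on \<open>V\<close>, its leading terms
  coercivity. It remains to approximate \<open>p\<close> by sums of squares in a weighted coefficient norm in
  which small errors are absorbed by \<open>(\<epsilon>/2) \<theta>\<^sub>r\<close>.

  In this norm \<open>sin (a x\<^sub>i) / a\<close> tends to \<open>x\<^sub>i\<close> as \<open>a\<close> tends to 0. For fixed \<open>a\<close>, a Bernstein certificate
  on the cube \<open>[-1/a, 1/a]\<^sup>n\<close> writes \<open>p (s/a)\<close> as a combination of products of powers of \<open>1 \<plusminus> s\<^sub>i\<close> with
  nonnegative coefficients, and for \<open>s\<^sub>i = sin (a x\<^sub>i)\<close> these factors are the squares
  \<open>(cos (a x\<^sub>i / 2) \<plusminus> sin (a x\<^sub>i / 2))\<^sup>2\<close>. Truncating the Taylor series gives polynomials. This replaces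
  the moment problem (Carleman's condition) by an explicit construction.
\<close>

section \<open>Polynomials, evaluation and sums of squares\<close>

text \<open>A positive polynomial need not be a sum of squares, and positivity certificates made for
  compact sets do not apply on all of R^n. The sine supplies the missing compactness: it maps the
  line into [-1, 1] while its rescaling stays close to the identity in the coefficient norm, so that
  positivity of p is only ever tested on a cube. The price is an approximant R whose degree is out
  of control. Hence the two halves of \<open>\<epsilon>\<close> have different duties. One is spent
  on a fixed \<open>theta d\<close> and makes p strictly positive before any approximation. The
  other must absorb p - R at whatever degree R has, with a constant independent of that degree;
  since a monomial of degree k is dominated by the diagonal powers in \<open>theta r\<close> at the
  cost of about the factorial of k / 2, this decides the weight of the norm. R cancels from the
  polynomial q of the dual certificate, so its degree enters only the lower bound on r.\<close>

lemma Cst_0 [simp]: "Cst 0 = 0"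
  and Cst_1 [simp]: "Cst 1 = 1"
  and Cst_add: "Cst (a + b) = Cst a + Cst b"
  and Cst_diff: "Cst (a - b) = Cst a - Cst b"
  and Cst_uminus: "Cst (- a) = - Cst a"
  and Cst_mult: "Cst (a * b) = Cst a * Cst b"
  by (simp_all add: Cst_def single_add single_diff single_uminus mult_single)

lemma Cst_sum: "Cst (sum h A) = (\<Sum>a\<in>A. Cst (h a))"
  by (induction A rule: infinite_finite_induct) (simp_all add: Cst_add)

lemma Cst_prod: "Cst (prod h A) = (\<Prod>a\<in>A. Cst (h a))"
  by (induction A rule: infinite_finite_induct) (simp_all add: Cst_mult)

lemma Cst_power: "Cst (a ^ k) = Cst a ^ k"
  by (induction k) (simp_all add: Cst_mult)

lemma Cst_numeral: "Cst (numeral k) = numeral k"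
  by (simp add: Cst_def)

lemma Cst_mult_single: "Cst c * Poly_Mapping.single \<alpha> a = Poly_Mapping.single \<alpha> (c * a)"
  by (simp add: Cst_def mult_single)

lemma rpoly_expand: "p = (\<Sum>\<alpha>\<in>Poly_Mapping.keys p. Poly_Mapping.single \<alpha> (Poly_Mapping.lookup p \<alpha>))"
proof (rule poly_mapping_eqI)
  fix \<beta>
  have "(\<Sum>\<alpha>\<in>Poly_Mapping.keys p. Poly_Mapping.lookup (Poly_Mapping.single \<alpha> (Poly_Mapping.lookup p \<alpha>)) \<beta>)
     = (\<Sum>\<alpha>\<in>Poly_Mapping.keys p. if \<alpha> = \<beta> then Poly_Mapping.lookup p \<alpha> else 0)"
    by (intro sum.cong) (auto simp: lookup_single when_def)
  also have "\<dots> = Poly_Mapping.lookup p \<beta>"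
    by (simp add: in_keys_iff)
  finally show "Poly_Mapping.lookup p \<beta> = Poly_Mapping.lookup
      (\<Sum>\<alpha>\<in>Poly_Mapping.keys p. Poly_Mapping.single \<alpha> (Poly_Mapping.lookup p \<alpha>)) \<beta>"
    by (simp add: lookup_sum)
qed

lemma X_power: "X i ^ k = Poly_Mapping.single (Poly_Mapping.single i k) 1"
proof (induction k)
  case (Suc k)
  have "Poly_Mapping.single i (Suc k) = Poly_Mapping.single i 1 + Poly_Mapping.single i k"
    by (simp flip: single_add)
  with Suc show ?case
    by (simp add: X_def mult_single)
qed simp

lemma expo_expand: "\<alpha> = (\<Sum>i\<in>UNIV. Poly_Mapping.single i (Poly_Mapping.lookup \<alpha> i))"
  for \<alpha> :: "'n::finite expo"
  by (rule poly_mapping_eqI) (simp add: lookup_sum lookup_single when_def)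

lemma prod_single_one: "(\<Prod>i\<in>A. Poly_Mapping.single (h i) (1::real)) = Poly_Mapping.single (\<Sum>i\<in>A. h i) 1"
  for h :: "'i \<Rightarrow> 'n expo"
  by (induction A rule: infinite_finite_induct) (simp_all add: mult_single)

lemma single_eq_prod_X:
  "Poly_Mapping.single \<alpha> c = Cst c * (\<Prod>i\<in>UNIV. X i ^ Poly_Mapping.lookup \<alpha> i)" for \<alpha> :: "'n::finite expo"
proof -
  have "(\<Prod>i\<in>UNIV. X i ^ Poly_Mapping.lookup \<alpha> i) = Poly_Mapping.single \<alpha> (1::real)"
    unfolding X_power prod_single_one by (simp flip: expo_expand)
  then show ?thesis by (simp add: Cst_mult_single)
qed

lemma abs_expo_0 [simp]: "abs_expo 0 = 0"
  by (simp add: abs_expo_def)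

lemma abs_expo_add: "abs_expo (\<alpha> + \<beta>) = abs_expo \<alpha> + abs_expo \<beta>"
  by (simp add: abs_expo_def lookup_add sum.distrib)

lemma abs_expo_single [simp]: "abs_expo (Poly_Mapping.single i k) = k"
  by (simp add: abs_expo_def lookup_single when_def)

lemma lookup_le_abs_expo: "Poly_Mapping.lookup \<alpha> i \<le> abs_expo \<alpha>" for \<alpha> :: "'n::finite expo"
  unfolding abs_expo_def by (rule member_le_sum) auto

lemma deg_le_iff: "deg p \<le> d \<longleftrightarrow> Poly_Mapping.keys p \<subseteq> expos d"
  by (auto simp: deg_def expos_def)

lemma abs_expo_le_deg: "\<alpha> \<in> Poly_Mapping.keys p \<Longrightarrow> abs_expo \<alpha> \<le> deg p"
  using deg_le_iff[of p "deg p"] by (auto simp: expos_def)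

lemma deg_add_le: "deg p \<le> d \<Longrightarrow> deg q \<le> d \<Longrightarrow> deg (p + q) \<le> d"
  using Poly_Mapping.keys_add[of p q] by (auto simp: deg_le_iff)

lemma deg_uminus [simp]: "deg (- p) = deg p"
  by (simp add: deg_def in_keys_iff[abs_def] Poly_Mapping.keys.rep_eq)

lemma deg_diff_le: "deg p \<le> d \<Longrightarrow> deg q \<le> d \<Longrightarrow> deg (p - q) \<le> d"
  using deg_add_le[of p d "- q"] by simp

lemma deg_0 [simp]: "deg 0 = 0"
  by (simp add: deg_def)

lemma deg_Cst [simp]: "deg (Cst c) = 0"
  by (simp add: deg_def Cst_def)

lemma deg_sum_le: "(\<And>a. a \<in> A \<Longrightarrow> deg (h a) \<le> d) \<Longrightarrow> deg (sum h A) \<le> d"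
  by (induction A rule: infinite_finite_induct) (auto intro: deg_add_le)

lemma deg_mult_le: "deg (p * q) \<le> deg p + deg q"
  using keys_mult[of p q] abs_expo_le_deg[of _ p] abs_expo_le_deg[of _ q]
  by (fastforce simp: deg_le_iff expos_def abs_expo_add intro: add_mono)

lemma deg_Cst_mult_le: "deg p \<le> d \<Longrightarrow> deg (Cst c * p) \<le> d"
  using deg_mult_le[of "Cst c" p] by simp

lemma deg_X_power: "deg (X i ^ k) = k"
  by (simp add: X_power deg_def)

lemma deg_theta_le: "deg (theta r) \<le> 2 * r"
  unfolding theta_def by (intro deg_sum_le deg_Cst_mult_le) (simp add: deg_X_power)

lemma mult_expand:
  "p * q = (\<Sum>\<alpha>\<in>Poly_Mapping.keys p. \<Sum>\<beta>\<in>Poly_Mapping.keys q.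
      Poly_Mapping.single (\<alpha> + \<beta>) (Poly_Mapping.lookup p \<alpha> * Poly_Mapping.lookup q \<beta>))"
  for p q :: "'n rpoly"
  by (subst (1) rpoly_expand[of p], subst (1) rpoly_expand[of q])
    (simp add: sum_product mult_single)

lemma lookup_sum_mult:
  "Poly_Mapping.lookup (p * q) \<gamma> =
    (\<Sum>\<alpha>\<in>Poly_Mapping.keys p. \<Sum>\<beta>\<in>Poly_Mapping.keys q.
      if \<alpha> + \<beta> = \<gamma> then Poly_Mapping.lookup p \<alpha> * Poly_Mapping.lookup q \<beta> else 0)"
  for p q :: "'n rpoly"
  by (subst mult_expand) (simp add: lookup_sum lookup_single when_def)

lemma riesz_superset:
  "finite K \<Longrightarrow> Poly_Mapping.keys p \<subseteq> K \<Longrightarrow> riesz y p = (\<Sum>\<alpha>\<in>K. Poly_Mapping.lookup p \<alpha> * y \<alpha>)"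
  unfolding riesz_def by (rule sum.mono_neutral_left) (auto simp: in_keys_iff)

lemma riesz_0 [simp]: "riesz y 0 = 0"
  by (simp add: riesz_def)

lemma riesz_single: "riesz y (Poly_Mapping.single \<alpha> c) = c * y \<alpha>"
  by (simp add: riesz_def)

lemma riesz_add: "riesz y (p + q) = riesz y p + riesz y q"
proof -
  define K where "K = Poly_Mapping.keys p \<union> Poly_Mapping.keys q"
  have "finite K" by (simp add: K_def)
  then show ?thesis
    using Poly_Mapping.keys_add[of p q]
    by (simp add: riesz_superset[of K] K_def lookup_add algebra_simps sum.distrib)
qed

lemma riesz_sum: "riesz y (sum h A) = (\<Sum>a\<in>A. riesz y (h a))"
  by (induction A rule: infinite_finite_induct) (simp_all add: riesz_add)

lemma riesz_Cst_mult: "riesz y (Cst c * p) = c * riesz y p"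
proof -
  have "riesz y (Cst c * p) = (\<Sum>\<alpha>\<in>Poly_Mapping.keys p. c * Poly_Mapping.lookup p \<alpha> * y \<alpha>)"
    by (subst rpoly_expand[of p]) (simp add: sum_distrib_left Cst_mult_single riesz_sum riesz_single)
  then show ?thesis
    by (simp add: riesz_def sum_distrib_left mult.assoc)
qed

lemma riesz_diff: "riesz y (p - q) = riesz y p - riesz y q"
  using riesz_add[of y "p - q" q] by simp

lemma riesz_mult:
  "riesz y (p * q) = (\<Sum>\<alpha>\<in>Poly_Mapping.keys p. \<Sum>\<beta>\<in>Poly_Mapping.keys q.
      Poly_Mapping.lookup p \<alpha> * Poly_Mapping.lookup q \<beta> * y (\<alpha> + \<beta>))"
  by (simp add: mult_expand riesz_sum riesz_single)

text \<open>The powers of a point form its (Dirac) moment sequence, so the rules for evaluation are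
  inherited from those for L_y. The same sequence later serves as a feasible point of the primal
  problem.\<close>

lemma eval_eq_riesz: "eval p x = riesz (\<lambda>\<alpha>. \<Prod>i\<in>UNIV. (x $ i) ^ Poly_Mapping.lookup \<alpha> i) p"
  by (simp add: eval_def riesz_def)

lemma eval_add: "eval (p + q) x = eval p x + eval q x"
  and eval_diff: "eval (p - q) x = eval p x - eval q x"
  and eval_sum: "eval (sum h A) x = (\<Sum>a\<in>A. eval (h a) x)"
  by (simp_all add: eval_eq_riesz riesz_add riesz_diff riesz_sum)

lemma eval_Cst [simp]: "eval (Cst c) x = c"
  by (simp add: eval_eq_riesz Cst_def riesz_single)

lemma eval_1 [simp]: "eval 1 x = 1"
  using eval_Cst[of 1] by simp

lemma eval_mult: "eval (p * q) x = eval p x * eval q x"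
  unfolding eval_eq_riesz riesz_mult
  by (simp add: riesz_def sum_product lookup_add power_add prod.distrib algebra_simps)

lemma eval_power: "eval (p ^ k) x = eval p x ^ k"
  by (induction k) (simp_all add: eval_mult)

lemma eval_X [simp]: "eval (X i) x = x $ i"
proof -
  have "(\<Prod>j\<in>UNIV. (x $ j) ^ Poly_Mapping.lookup (Poly_Mapping.single i 1) j)
      = (\<Prod>j\<in>UNIV. if j = i then x $ i else 1)"
    by (intro prod.cong) (auto simp: lookup_single when_def)
  then show ?thesis
    by (simp add: eval_eq_riesz X_def riesz_single)
qed

lemma continuous_on_eval: "continuous_on S (eval p)"
  unfolding eval_def by (intro continuous_intros)

lemma eval_theta: "eval (theta r) x = (\<Sum>k=0..r. \<Sum>i\<in>UNIV. (x $ i) ^ (2 * k) / fact k)"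
  by (simp add: theta_def eval_sum eval_mult eval_power)

lemma sos_0 [simp]: "sos 0"
  unfolding sos_def by (rule exI[of _ "[]"]) simp

lemma sos_add: "sos p \<Longrightarrow> sos q \<Longrightarrow> sos (p + q)"
  unfolding sos_def by (metis map_append sum_list_append)

lemma sos_power2: "sos (p\<^sup>2)"
  unfolding sos_def by (rule exI[of _ "[p]"]) simp

lemma sos_even_power: "even k \<Longrightarrow> sos (p ^ k)"
  using sos_power2[of "p ^ (k div 2)"] by (simp flip: power_mult)

lemma sos_Cst: "c \<ge> 0 \<Longrightarrow> sos (Cst c)"
  using sos_power2[of "Cst (sqrt c)"] by (simp flip: Cst_power)

lemma sos_1 [simp]: "sos 1"
  using sos_Cst[of 1] by simp

lemma sos_mult:
  fixes p q :: "'n rpoly"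
  assumes "sos p" "sos q"
  shows "sos (p * q)"
proof -
  obtain ps qs where p: "p = (\<Sum>p\<leftarrow>ps. p\<^sup>2)" and q: "q = (\<Sum>p\<leftarrow>qs. p\<^sup>2)"
    using assms unfolding sos_def by blast
  have "sos (a\<^sup>2 * (\<Sum>p\<leftarrow>qs. p\<^sup>2))" for a
    by (induction qs) (auto simp: algebra_simps simp flip: power_mult_distrib intro!: sos_add sos_power2)
  then show ?thesis
    unfolding p q by (induction ps) (auto simp: algebra_simps intro!: sos_add)
qed

lemma sos_sum: "(\<And>a. a \<in> A \<Longrightarrow> sos (h a)) \<Longrightarrow> sos (sum h A)"
  by (induction A rule: infinite_finite_induct) (auto intro: sos_add)

lemma sos_prod: "(\<And>a. a \<in> A \<Longrightarrow> sos (h a)) \<Longrightarrow> sos (prod h A)"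
  by (induction A rule: infinite_finite_induct) (auto intro: sos_mult)

lemma sos_power: "sos p \<Longrightarrow> sos (p ^ k)"
  by (induction k) (auto intro: sos_mult)

lemma sos_Cst_mult: "c \<ge> 0 \<Longrightarrow> sos p \<Longrightarrow> sos (Cst c * p)"
  by (intro sos_mult sos_Cst)

section \<open>Weak duality and domination of monomials\<close>

text \<open>In a sum of squares of polynomials the leading terms cannot cancel. Without an order on the
  variables, the leading exponent is taken to maximize \<open>\<Sum>\<^sub>i \<alpha>\<^sub>i\<^sup>2\<close> among those of top degree:
  by strict convexity, it then is not the midpoint of two other exponents.\<close>

lemma deg_le_if_sum_squares:
  fixes ps :: "'n::finite rpoly list"
  assumes deg: "deg (\<Sum>p\<leftarrow>ps. p\<^sup>2) \<le> 2 * r" and "p \<in> set ps"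
  shows "deg p \<le> r"
proof -
  define K where "K = (\<Union>p\<in>set ps. Poly_Mapping.keys p)"
  have fin: "finite K" by (auto simp: K_def)
  have "K \<subseteq> expos r"
  proof (rule ccontr)
    assume "\<not> K \<subseteq> expos r"
    then obtain \<alpha>0 where \<alpha>0: "\<alpha>0 \<in> K" "abs_expo \<alpha>0 > r"
      by (auto simp: expos_def not_le subset_iff)
    define d where "d = Max (abs_expo ` K)"
    have le_d: "abs_expo \<beta> \<le> d" if "\<beta> \<in> K" for \<beta>
      unfolding d_def using fin that by auto
    have "d \<in> abs_expo ` K" unfolding d_def using fin \<alpha>0 by (intro Max_in) auto
    then have ne: "{\<beta>\<in>K. abs_expo \<beta> = d} \<noteq> {}" by auto
    define Q :: "'n expo \<Rightarrow> nat" where "Q \<beta> = (\<Sum>i\<in>UNIV. (Poly_Mapping.lookup \<beta> i)\<^sup>2)" for \<beta>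
    obtain \<alpha> where \<alpha>: "\<alpha> \<in> K" "abs_expo \<alpha> = d"
      and Qmax: "\<And>\<beta>. \<beta> \<in> K \<Longrightarrow> abs_expo \<beta> = d \<Longrightarrow> Q \<beta> \<le> Q \<alpha>"
    proof -
      let ?S = "{\<beta>\<in>K. abs_expo \<beta> = d}"
      have "Max (Q ` ?S) \<in> Q ` ?S" using fin ne by (intro Max_in) auto
      then obtain \<alpha> where "\<alpha> \<in> ?S" "Q \<alpha> = Max (Q ` ?S)" by auto
      then show ?thesis using that[of \<alpha>] fin by auto
    qed
    have unique: "\<beta> = \<alpha> \<and> \<gamma> = \<alpha>" if "\<beta> \<in> K" "\<gamma> \<in> K" and sum: "\<beta> + \<gamma> = \<alpha> + \<alpha>" for \<beta> \<gamma>
    proof -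
      have "abs_expo \<beta> + abs_expo \<gamma> = 2 * d"
        using arg_cong[OF sum, of abs_expo] \<alpha> by (simp add: abs_expo_add)
      then have "abs_expo \<beta> = d" "abs_expo \<gamma> = d"
        using le_d[of \<beta>] le_d[of \<gamma>] that by auto
      then have "Q \<beta> \<le> Q \<alpha>" "Q \<gamma> \<le> Q \<alpha>" using Qmax that by auto
      let ?b = "\<lambda>i. int (Poly_Mapping.lookup \<beta> i)" and ?c = "\<lambda>i. int (Poly_Mapping.lookup \<gamma> i)"
      let ?a = "\<lambda>i. int (Poly_Mapping.lookup \<alpha> i)"
      have bc: "?b i + ?c i = 2 * ?a i" for i
        using arg_cong[OF sum, of "\<lambda>e. Poly_Mapping.lookup e i"] by (simp add: lookup_add)
      \<comment> \<open>Parallelogram identity at the midpoint a of b and c. Summed over i, its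
        right-hand side is at most 0 by the maximality of \<open>Q \<alpha>\<close>, which forces b
        = a.\<close>
      have "(?b i - ?a i)\<^sup>2 * 2 = (?b i)\<^sup>2 + (?c i)\<^sup>2 - 2 * (?a i)\<^sup>2" for i
      proof -
        have "?c i = 2 * ?a i - ?b i" using bc[of i] by simp
        then show ?thesis by (simp only:) (simp add: power2_eq_square algebra_simps)
      qed
      then have "(\<Sum>i\<in>UNIV. (?b i - ?a i)\<^sup>2) * 2 = int (Q \<beta>) + int (Q \<gamma>) - 2 * int (Q \<alpha>)"
        by (simp add: sum_distrib_right Q_def sum.distrib sum_subtractf sum_distrib_left)
      also have "\<dots> \<le> 0" using \<open>Q \<beta> \<le> Q \<alpha>\<close> \<open>Q \<gamma> \<le> Q \<alpha>\<close> by simp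
      finally have "(\<Sum>i\<in>UNIV. (?b i - ?a i)\<^sup>2) = 0"
        using sum_nonneg[of UNIV "\<lambda>i. (?b i - ?a i)\<^sup>2"] by simp
      then have "?b i = ?a i" for i by (simp add: sum_nonneg_eq_0_iff)
      then have "\<beta> = \<alpha>" by (intro poly_mapping_eqI) simp
      with sum show ?thesis by simp
    qed
    \<comment> \<open>By \<open>unique\<close>, only the diagonal pair contributes to this
      coefficient. It is a square for every member of the list, so no cancellation can
      occur.\<close>
    have coeff: "Poly_Mapping.lookup (p\<^sup>2) (\<alpha> + \<alpha>) = (Poly_Mapping.lookup p \<alpha>)\<^sup>2" if "p \<in> set ps" for p
    proof -
      have sub: "Poly_Mapping.keys p \<subseteq> K" using that by (auto simp: K_def)
      have "Poly_Mapping.lookup (p\<^sup>2) (\<alpha> + \<alpha>) = (\<Sum>\<beta>\<in>Poly_Mapping.keys p. \<Sum>\<gamma>\<in>Poly_Mapping.keys p.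
          if \<gamma> = \<alpha> then if \<beta> = \<alpha> then (Poly_Mapping.lookup p \<alpha>)\<^sup>2 else 0 else 0)"
        unfolding power2_eq_square lookup_sum_mult
        using sub unique by (intro sum.cong refl) (metis (no_types, opaque_lifting) subsetD)
      then show ?thesis
        by (cases "\<alpha> \<in> Poly_Mapping.keys p") (auto simp: not_in_keys_iff_lookup_eq_zero)
    qed
    have "Poly_Mapping.lookup (\<Sum>p\<leftarrow>ps. p\<^sup>2) (\<alpha> + \<alpha>) = (\<Sum>p\<leftarrow>ps. (Poly_Mapping.lookup p \<alpha>)\<^sup>2)"
      using coeff by (induction ps) (simp_all add: lookup_add)
    also have "\<dots> > 0"
    proof -
      obtain p where "p \<in> set ps" "Poly_Mapping.lookup p \<alpha> \<noteq> 0"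
        using \<alpha> by (auto simp: K_def in_keys_iff)
      then have "(\<Sum>p\<leftarrow>ps. (Poly_Mapping.lookup p \<alpha>)\<^sup>2) \<noteq> 0"
        by (subst sum_list_nonneg_eq_0_iff) auto
      moreover have "(\<Sum>p\<leftarrow>ps. (Poly_Mapping.lookup p \<alpha>)\<^sup>2) \<ge> 0"
        by (intro sum_list_nonneg) auto
      ultimately show ?thesis by simp
    qed
    finally have "\<alpha> + \<alpha> \<in> Poly_Mapping.keys (\<Sum>p\<leftarrow>ps. p\<^sup>2)" by (simp add: in_keys_iff)
    from abs_expo_le_deg[OF this] deg \<alpha> have "d \<le> r" by (simp add: abs_expo_add)
    with le_d[OF \<alpha>0(1)] \<alpha>0(2) show False by simp
  qed
  then show ?thesis using assms(2) by (auto simp: deg_le_iff K_def)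
qed

lemma riesz_square_nonneg:
  assumes "psd (expos r) (moment_matrix y)" and "deg p \<le> r"
  shows "riesz y (p\<^sup>2) \<ge> 0"
proof -
  have sub: "Poly_Mapping.keys p \<subseteq> expos r" using assms(2) by (simp add: deg_le_iff)
  let ?h = "\<lambda>\<alpha> \<beta>. Poly_Mapping.lookup p \<alpha> * y (\<alpha> + \<beta>) * Poly_Mapping.lookup p \<beta>"
  have "riesz y (p\<^sup>2) = (\<Sum>\<alpha>\<in>Poly_Mapping.keys p. \<Sum>\<beta>\<in>Poly_Mapping.keys p. ?h \<alpha> \<beta>)"
    unfolding power2_eq_square riesz_mult by (simp add: algebra_simps)
  also have "\<dots> = (\<Sum>\<alpha>\<in>Poly_Mapping.keys p. \<Sum>\<beta>\<in>expos r. ?h \<alpha> \<beta>)"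
    using sub by (intro sum.cong sum.mono_neutral_left finite_expos) (auto simp: in_keys_iff)
  also have "\<dots> = (\<Sum>\<alpha>\<in>expos r. \<Sum>\<beta>\<in>expos r. ?h \<alpha> \<beta>)"
    using sub by (intro sum.mono_neutral_left finite_expos) (auto simp: in_keys_iff)
  also have "\<dots> \<ge> 0"
    using assms(1) unfolding psd_def moment_matrix_def by auto
  finally show ?thesis .
qed

text \<open>Positive semidefiniteness of the moment matrix speaks only about squares of polynomials
  of degree at most r; the degree bound on the whole sum has to be passed down to its
  summands.\<close>

lemma riesz_sos_nonneg:
  assumes "psd (expos r) (moment_matrix y)" and "sos q" and "deg q \<le> 2 * r"
  shows "riesz y q \<ge> 0"
proof -
  obtain ps where q: "q = (\<Sum>p\<leftarrow>ps. p\<^sup>2)" using assms(2) by (auto simp: sos_def)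
  have nonneg: "riesz y (p\<^sup>2) \<ge> 0" if "p \<in> set ps" for p
    using deg_le_if_sum_squares[of ps r p] assms that q by (intro riesz_square_nonneg) auto
  have "riesz y q = (\<Sum>p\<leftarrow>ps. riesz y (p\<^sup>2))"
    unfolding q by (induction ps) (simp_all add: riesz_add)
  also have "\<dots> \<ge> 0" using nonneg by (intro sum_list_nonneg) auto
  finally show ?thesis .
qed

text \<open>Apply L_y to the dual identity: L_y(q) is nonnegative and each multiplier contributes a
  nonpositive amount. Arguing with bounds of extended reals covers infeasible problems too.\<close>

lemma weak_duality: "sup_Qdual f m g \<epsilon> r \<le> inf_Q f m g \<epsilon> r"
  unfolding sup_Qdual_def inf_Q_def
proof (intro SUP_least INF_greatest)
  fix d y
  assume "d \<in> Qdual_feasible f m g \<epsilon> r" and y: "y \<in> Q_feasible m g r"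
  then obtain l \<gamma> q where d: "d = (l, \<gamma>, q)" and l: "l \<in> {1..m} \<rightarrow>\<^sub>E {0..}" and q: "sos q" "deg q \<le> 2 * r"
    and eq: "perturb f \<epsilon> r - Cst \<gamma> = q - (\<Sum>j=1..m. Cst (l j) * (g j)\<^sup>2)"
    unfolding Qdual_feasible_def by blast
  have "riesz y (Cst \<gamma>) = \<gamma>"
    using y by (simp add: Cst_def riesz_single Q_feasible_def)
  then have "riesz y (perturb f \<epsilon> r) - \<gamma> = riesz y q - (\<Sum>j=1..m. l j * riesz y ((g j)\<^sup>2))"
    using arg_cong[OF eq, of "riesz y"] by (simp add: riesz_diff riesz_sum riesz_Cst_mult)
  moreover have "riesz y q \<ge> 0"
    using y q by (intro riesz_sos_nonneg[of r]) (auto simp: Q_feasible_def)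
  moreover have "l j * riesz y ((g j)\<^sup>2) \<le> 0" if "j \<in> {1..m}" for j
    using l y that by (intro mult_nonneg_nonpos) (auto simp: Q_feasible_def PiE_def Pi_def)
  then have "(\<Sum>j=1..m. l j * riesz y ((g j)\<^sup>2)) \<le> 0"
    by (intro sum_nonpos) auto
  ultimately have "\<gamma> \<le> riesz y (perturb f \<epsilon> r)" by linarith
  then show "(case d of (l, \<gamma>, q) \<Rightarrow> ereal \<gamma>) \<le> ereal (riesz y (perturb f \<epsilon> r))"
    by (simp add: d)
qed

lemma deg_perturb_le: "deg f \<le> 2 * r \<Longrightarrow> deg (perturb f \<epsilon> r) \<le> 2 * r"
  unfolding perturb_def by (intro deg_add_le deg_Cst_mult_le deg_theta_le)

text \<open>The moment sequence of a point of the zero set, cut off at degree 2r, is feasible: its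
  moment matrix has rank one, and its functional is evaluation at the point.\<close>

lemma inf_Q_le_eval:
  fixes x :: "real ^ 'n::finite"
  assumes x: "x \<in> zeros m g" and f: "deg f \<le> 2 * r" and g: "\<And>j. j \<in> {1..m} \<Longrightarrow> deg ((g j)\<^sup>2) \<le> 2 * r"
  shows "inf_Q f m g \<epsilon> r \<le> ereal (eval (perturb f \<epsilon> r) x)"
proof -
  let ?mon = "\<lambda>\<alpha>. \<Prod>i\<in>UNIV. (x $ i) ^ Poly_Mapping.lookup \<alpha> i"
  define y where "y = restrict ?mon (expos (2 * r))"
  have riesz_y: "riesz y p = eval p x" if "deg p \<le> 2 * r" for p
    using that unfolding deg_le_iff eval_eq_riesz riesz_def y_def by (intro sum.cong) auto
  have y_mon: "y (\<alpha> + \<beta>) = ?mon \<alpha> * ?mon \<beta>" if "\<alpha> \<in> expos r" "\<beta> \<in> expos r" for \<alpha> \<beta>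
    using that by (simp add: y_def expos_def abs_expo_add lookup_add power_add prod.distrib)
  have "psd (expos r) (moment_matrix y)"
    unfolding psd_def moment_matrix_def
  proof (intro conjI ballI allI)
    fix v
    have "(\<Sum>\<alpha>\<in>expos r. \<Sum>\<beta>\<in>expos r. v \<alpha> * y (\<alpha> + \<beta>) * v \<beta>)
        = (\<Sum>\<alpha>\<in>expos r. v \<alpha> * ?mon \<alpha>)\<^sup>2"
      by (simp add: power2_eq_square sum_product y_mon algebra_simps)
    then show "0 \<le> (\<Sum>\<alpha>\<in>expos r. \<Sum>\<beta>\<in>expos r. v \<alpha> * y (\<alpha> + \<beta>) * v \<beta>)" by simp
  qed (simp add: add.commute)
  moreover have "riesz y ((g j)\<^sup>2) \<le> 0" if "j \<in> {1..m}" for j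
    using that x g by (simp add: riesz_y eval_power zeros_def)
  moreover have "y 0 = 1" by (simp add: y_def expos_def)
  ultimately have "y \<in> Q_feasible m g r"
    by (auto simp: Q_feasible_def y_def)
  then have "inf_Q f m g \<epsilon> r \<le> ereal (riesz y (perturb f \<epsilon> r))"
    unfolding inf_Q_def by (rule INF_lower)
  then show ?thesis using deg_perturb_le[OF f] by (simp add: riesz_y)
qed

section \<open>Domination of monomials by the diagonal powers in \<open>theta\<close>\<close>

text \<open>Put P = p^2 and Q = q^2. The polynomial equals (P^a - Q^a) (P^b - Q^b) + P^b Q^a, and
  both differences are P - Q times a sum of squares, so their product carries the square (P -
  Q)^2.\<close>

lemma sos_mixed_power_le:
  fixes p q :: "'n rpoly"
  shows "sos (p ^ (2 * (a + b)) + q ^ (2 * (a + b)) - p ^ (2 * a) * q ^ (2 * b))"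
proof -
  have diff: "\<exists>h. sos h \<and> (p\<^sup>2) ^ k - (q\<^sup>2) ^ k = (p\<^sup>2 - q\<^sup>2) * h" for k
    by (rule exI[of _ "\<Sum>i<k. (q\<^sup>2) ^ (k - Suc i) * (p\<^sup>2) ^ i"])
      (auto simp: power_diff_sumr2 intro!: sos_sum sos_mult sos_power sos_power2)
  obtain h h' where h: "sos h" "(p\<^sup>2) ^ a - (q\<^sup>2) ^ a = (p\<^sup>2 - q\<^sup>2) * h"
    and h': "sos h'" "(p\<^sup>2) ^ b - (q\<^sup>2) ^ b = (p\<^sup>2 - q\<^sup>2) * h'"
    using diff by metis
  have "p ^ (2 * (a + b)) + q ^ (2 * (a + b)) - p ^ (2 * a) * q ^ (2 * b)
      = ((p\<^sup>2) ^ a - (q\<^sup>2) ^ a) * ((p\<^sup>2) ^ b - (q\<^sup>2) ^ b) + (p\<^sup>2) ^ b * (q\<^sup>2) ^ a"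
    by (simp only: power_mult power_add distrib_left) (simp only: ring_distribs ac_simps, simp)
  also have "\<dots> = (p\<^sup>2 - q\<^sup>2)\<^sup>2 * (h * h') + (p\<^sup>2) ^ b * (q\<^sup>2) ^ a"
    unfolding h h' by (simp add: power2_eq_square algebra_simps)
  finally show ?thesis
    using h h' by (auto intro!: sos_add sos_mult sos_power sos_power2)
qed

text \<open>The inequality for two factors, applied one factor at a time. What matters is that
  \<open>C\<close> precedes \<open>\<beta>\<close>: a single constant serves monomials of every
  degree.\<close>

lemma sos_prod_even_power_le:
  fixes p :: "'i \<Rightarrow> 'n rpoly"
  assumes "finite I" "I \<noteq> {}"
  shows "\<exists>C\<ge>0. \<forall>\<beta>. sos (Cst C * (\<Sum>i\<in>I. p i ^ (2 * sum \<beta> I)) - (\<Prod>i\<in>I. p i ^ (2 * \<beta> i)))"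
  using assms
proof (induction rule: finite_ne_induct)
  case (singleton i)
  show ?case by (rule exI[of _ 1]) simp
next
  case (insert j I)
  then obtain C where C: "C \<ge> 0"
    and IH: "\<And>\<beta>. sos (Cst C * (\<Sum>i\<in>I. p i ^ (2 * sum \<beta> I)) - (\<Prod>i\<in>I. p i ^ (2 * \<beta> i)))" by blast
  \<comment> \<open>Splitting all the products \<open>p i ^ (2 * d) * p j ^ (2 * b)\<close> costs
    \<open>C\<close> on each i-th power and \<open>C\<close> times \<open>card I\<close> on the
    j-th. This common coefficient covers both; the surplus is \<open>s3\<close>.\<close>
  define C' where "C' = C * (1 + real (card I))"
  have "sos (Cst C' * (\<Sum>i\<in>insert j I. p i ^ (2 * sum \<beta> (insert j I))) - (\<Prod>i\<in>insert j I. p i ^ (2 * \<beta> i)))"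
    for \<beta>
  proof -
    define d b where "d = sum \<beta> I" and "b = \<beta> j"
    let ?P = "\<Prod>i\<in>I. p i ^ (2 * \<beta> i)" and ?S = "\<Sum>i\<in>I. p i ^ (2 * (d + b))"
    have s1: "sos ((Cst C * (\<Sum>i\<in>I. p i ^ (2 * d)) - ?P) * p j ^ (2 * b))"
      using IH[of \<beta>] by (intro sos_mult sos_even_power) (auto simp: d_def)
    have s2: "sos (Cst C * (\<Sum>i\<in>I. p i ^ (2 * (d + b)) + p j ^ (2 * (d + b)) - p i ^ (2 * d) * p j ^ (2 * b)))"
      using C by (intro sos_Cst_mult sos_sum sos_mixed_power_le)
    have s3: "sos (Cst C * Cst (real (card I)) * ?S + Cst C * p j ^ (2 * (d + b)))"
      using C by (intro sos_add sos_mult sos_Cst sos_sum sos_even_power) auto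
    have "Cst C' * (?S + p j ^ (2 * (d + b))) - ?P * p j ^ (2 * b)
      = (Cst C * (\<Sum>i\<in>I. p i ^ (2 * d)) - ?P) * p j ^ (2 * b)
        + Cst C * (\<Sum>i\<in>I. p i ^ (2 * (d + b)) + p j ^ (2 * (d + b)) - p i ^ (2 * d) * p j ^ (2 * b))
        + (Cst C * Cst (real (card I)) * ?S + Cst C * p j ^ (2 * (d + b)))"
    proof -
      have "of_nat (card I) = (Cst (real (card I)) :: 'n rpoly)" by (simp add: Cst_def)
      then show ?thesis
        by (simp add: C'_def Cst_mult Cst_add sum.distrib sum_subtractf sum_distrib_right
            sum_distrib_left algebra_simps)
    qed
    with s1 s2 s3 have "sos (Cst C' * (?S + p j ^ (2 * (d + b))) - ?P * p j ^ (2 * b))"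
      by (simp add: sos_add)
    then show ?thesis using insert by (simp add: d_def b_def add.commute mult.commute)
  qed
  moreover have "C' \<ge> 0" using C by (simp add: C'_def)
  ultimately show ?case by blast
qed

text \<open>Used to cut an exponent into two halves whose sizes differ by at most one.\<close>

lemma expo_split:
  fixes \<alpha> :: "'n::finite expo"
  shows "k \<le> abs_expo \<alpha> \<Longrightarrow> \<exists>\<beta> \<gamma>. \<alpha> = \<beta> + \<gamma> \<and> abs_expo \<beta> = k"
proof (induction k)
  case 0
  show ?case by (rule exI[of _ 0]) simp
next
  case (Suc k)
  then obtain \<beta> \<gamma> where \<alpha>: "\<alpha> = \<beta> + \<gamma>" and \<beta>: "abs_expo \<beta> = k" by auto
  then have "abs_expo \<gamma> \<noteq> 0" using Suc.prems by (simp add: abs_expo_add)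
  then obtain i where i: "Poly_Mapping.lookup \<gamma> i \<noteq> 0" by (auto simp: abs_expo_def)
  let ?e = "Poly_Mapping.single i 1"
  have "\<gamma> = ?e + (\<gamma> - ?e)"
    using i by (intro poly_mapping_eqI) (auto simp: lookup_add lookup_minus lookup_single when_def)
  then have "\<alpha> = (\<beta> + ?e) + (\<gamma> - ?e)" using \<alpha> by (simp add: add.assoc)
  moreover have "abs_expo (\<beta> + ?e) = Suc k" by (simp add: abs_expo_add \<beta>)
  ultimately show ?case by blast
qed

lemma sos_theta_diff:
  assumes "r \<le> s"
  shows "sos (theta s - theta r :: 'n::finite rpoly)"
proof -
  let ?h = "\<lambda>k. \<Sum>i\<in>UNIV. Cst (1 / fact k) * X i ^ (2 * k) :: 'n rpoly"
  have "sum ?h {0..s} = sum ?h {0..r} + sum ?h {r<..s}"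
    using \<open>r \<le> s\<close> by (subst sum.union_disjoint[symmetric]) (auto intro: sum.cong)
  moreover have "sos (sum ?h {r<..s})"
    by (intro sos_sum sos_Cst_mult sos_even_power) auto
  ultimately show ?thesis by (simp add: theta_def)
qed

lemma sos_theta: "sos (theta r)"
  unfolding theta_def by (intro sos_sum sos_Cst_mult sos_even_power) auto

lemma sos_theta_minus_powers:
  assumes "k \<le> r"
  shows "sos (Cst (fact k) * theta r - (\<Sum>i\<in>UNIV. X i ^ (2 * k)))"
proof -
  let ?h = "\<lambda>k. \<Sum>i\<in>UNIV. Cst (1 / fact k) * X i ^ (2 * k) :: 'a rpoly"
  have "theta r = ?h k + sum ?h ({0..r} - {k})"
    unfolding theta_def using assms by (subst sum.remove[of _ k]) auto
  then have "Cst (fact k) * theta r - (\<Sum>i\<in>UNIV. X i ^ (2 * k)) = Cst (fact k) * sum ?h ({0..r} - {k})"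
    by (simp add: algebra_simps sum_distrib_left flip: Cst_mult mult.assoc)
  also have "sos \<dots>"
    by (intro sos_sum sos_Cst_mult sos_even_power) auto
  finally show ?thesis .
qed

text \<open>The critical case is d = 2k - 1, where (2k - 1)! is k! (k - 1)! times a binomial
  coefficient that is at least k. It arises for monomials of odd degree, whose larger half has
  degree (d + 1) / 2.\<close>

lemma fact_half_le: "2 * k \<le> d + 1 \<Longrightarrow> fact k \<le> sqrt (fact d)"
proof -
  assume "2 * k \<le> d + 1"
  have "(fact k)\<^sup>2 \<le> (fact d :: nat)"
  proof (cases k)
    case (Suc l)
    have "(fact k)\<^sup>2 = k * (fact k * fact l :: nat)"
      using Suc by (simp add: power2_eq_square algebra_simps)
    also have "k \<le> (k + l) choose l"
    proof (cases l)
      case (Suc l')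
      have "(k + l) choose 1 \<le> (k + l) choose l"
        using \<open>k = Suc l\<close> Suc by (intro binomial_mono) auto
      then show ?thesis by simp
    qed (use Suc in simp)
    then have "k * (fact k * fact l :: nat) \<le> ((k + l) choose l) * (fact k * fact l)" by simp
    also have "\<dots> = fact (k + l)"
      using binomial_fact_lemma[of l "k + l"] by (simp add: algebra_simps)
    also have "\<dots> \<le> fact d" using \<open>2 * k \<le> d + 1\<close> Suc by (intro fact_mono) auto
    finally show ?thesis .
  qed simp
  then have "(fact k :: real)\<^sup>2 \<le> fact d"
    by (metis of_nat_fact of_nat_le_iff of_nat_power)
  then show ?thesis by (simp add: real_le_rsqrt)
qed

text \<open>Up to its sign, the monomial is a product B G of monomials of nearly half the degree,
  and B^2 + G^2 + 2 B G or B^2 + G^2 - 2 B G is a square. B^2 and G^2 are dominated by diagonal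
  powers, and these by \<open>theta r\<close>. No parity condition on the exponent is needed, and
  \<open>C\<close> is uniform in the exponent and in r.\<close>

lemma sos_monomial_plus_theta:
  "\<exists>C\<ge>0. \<forall>(\<alpha> :: 'n::finite expo) r c. abs_expo \<alpha> \<le> 2 * r \<longrightarrow>
     sos (Poly_Mapping.single \<alpha> c + Cst (\<bar>c\<bar> * (C * sqrt (fact (abs_expo \<alpha>)))) * theta r)"
proof -
  obtain C where C: "C \<ge> 0"
    and dom: "\<And>\<beta>. sos (Cst C * (\<Sum>i\<in>UNIV. X i ^ (2 * sum \<beta> UNIV)) - (\<Prod>i\<in>UNIV. (X i :: 'n rpoly) ^ (2 * \<beta> i)))"
    using sos_prod_even_power_le[of "UNIV :: 'n set" "X :: 'n \<Rightarrow> 'n rpoly"] by auto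
  have square: "sos (Cst (C * sqrt (fact (abs_expo \<alpha>))) * theta r - (Poly_Mapping.single \<beta> 1)\<^sup>2)"
    if "abs_expo \<beta> \<le> r" "2 * abs_expo \<beta> \<le> abs_expo \<alpha> + 1" for \<alpha> \<beta> :: "'n expo" and r
  proof -
    define k where "k = abs_expo \<beta>"
    have "(Poly_Mapping.single \<beta> 1)\<^sup>2 = (\<Prod>i\<in>UNIV. (X i :: 'n rpoly) ^ (2 * Poly_Mapping.lookup \<beta> i))"
      by (simp add: single_eq_prod_X prod_power_distrib power_even_eq)
    then have 1: "sos (Cst C * (\<Sum>i\<in>UNIV. X i ^ (2 * k)) - (Poly_Mapping.single \<beta> 1)\<^sup>2)"
      using dom[of "Poly_Mapping.lookup \<beta>"] by (simp add: k_def abs_expo_def)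
    have 2: "sos (Cst C * (Cst (fact k) * theta r - (\<Sum>i\<in>UNIV. (X i :: 'n rpoly) ^ (2 * k))))"
      using that C by (intro sos_Cst_mult sos_theta_minus_powers) (auto simp: k_def)
    have 3: "sos (Cst (C * (sqrt (fact (abs_expo \<alpha>)) - fact k)) * (theta r :: 'n rpoly))"
      using that C fact_half_le[of k "abs_expo \<alpha>"]
      by (intro sos_Cst_mult sos_theta mult_nonneg_nonneg) (auto simp: k_def)
    have "Cst (C * sqrt (fact (abs_expo \<alpha>))) * theta r - (Poly_Mapping.single \<beta> 1)\<^sup>2
      = (Cst C * (\<Sum>i\<in>UNIV. X i ^ (2 * k)) - (Poly_Mapping.single \<beta> 1)\<^sup>2)
        + Cst C * (Cst (fact k) * theta r - (\<Sum>i\<in>UNIV. (X i :: 'n rpoly) ^ (2 * k)))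
        + Cst (C * (sqrt (fact (abs_expo \<alpha>)) - fact k)) * (theta r :: 'n rpoly)"
      by (simp add: Cst_mult Cst_diff algebra_simps)
    also have "sos \<dots>" by (intro sos_add 1 2 3)
    finally show ?thesis .
  qed
  show ?thesis
  proof (intro exI[of _ C] conjI allI impI C)
    fix \<alpha> :: "'n expo" and r c
    assume r: "abs_expo \<alpha> \<le> 2 * r"
    obtain \<beta> \<gamma> where \<alpha>: "\<alpha> = \<beta> + \<gamma>" and \<beta>: "abs_expo \<beta> = abs_expo \<alpha> div 2"
      using expo_split[of "abs_expo \<alpha> div 2" \<alpha>] by auto
    define B G where "B = Poly_Mapping.single \<beta> (1::real)" and "G = Poly_Mapping.single \<gamma> (1::real)"
    define w where "w = C * sqrt (fact (abs_expo \<alpha>))"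
    have s: "sos (Cst w * theta r - B\<^sup>2)" "sos (Cst w * theta r - G\<^sup>2)"
    proof -
      have "abs_expo \<alpha> = abs_expo \<beta> + abs_expo \<gamma>" by (simp add: \<alpha> abs_expo_add)
      then have "abs_expo \<beta> \<le> r" "2 * abs_expo \<beta> \<le> abs_expo \<alpha> + 1"
        "abs_expo \<gamma> \<le> r" "2 * abs_expo \<gamma> \<le> abs_expo \<alpha> + 1"
        using r \<beta> by linarith+
      then show "sos (Cst w * theta r - B\<^sup>2)" "sos (Cst w * theta r - G\<^sup>2)"
        unfolding B_def G_def w_def by (auto intro: square)
    qed
    have single: "Poly_Mapping.single \<alpha> c = Cst c * (B * G)"
      by (simp add: B_def G_def \<alpha> mult_single Cst_mult_single)
    \<comment> \<open>Not the function \<open>sgn\<close>: the square of \<open>s'\<close> has to be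
      1 for c = 0 as well.\<close>
    define s' where "s' = (if c \<ge> 0 then 1 else - 1 :: real)"
    have s': "c = \<bar>c\<bar> * s'" "s' * s' = 1" by (auto simp: s'_def)
    have "Poly_Mapping.single \<alpha> c + Cst (\<bar>c\<bar> * w) * theta r
        = Cst (\<bar>c\<bar> / 2) * ((B + Cst s' * G)\<^sup>2 + (Cst w * theta r - B\<^sup>2) + (Cst w * theta r - G\<^sup>2))"
    proof -
      have "(B + Cst s' * G)\<^sup>2 = B\<^sup>2 + (Cst s' * Cst s') * G\<^sup>2 + 2 * Cst s' * (B * G)"
        by (simp add: power2_eq_square algebra_simps)
      also have "Cst s' * Cst s' = (1 :: 'n rpoly)"
        using s'(2) by (metis Cst_mult Cst_1)
      finally have "(B + Cst s' * G)\<^sup>2 = B\<^sup>2 + G\<^sup>2 + 2 * Cst s' * (B * G)" by simp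
      then have "Cst (\<bar>c\<bar> / 2) * ((B + Cst s' * G)\<^sup>2 + (Cst w * theta r - B\<^sup>2) + (Cst w * theta r - G\<^sup>2))
        = Cst (\<bar>c\<bar> / 2) * 2 * (Cst s' * (B * G) + Cst w * theta r)"
        by (simp add: algebra_simps)
      also have "Cst (\<bar>c\<bar> / 2) * 2 = (Cst \<bar>c\<bar> :: 'n rpoly)"
        unfolding Cst_numeral[symmetric] Cst_mult[symmetric] by simp
      finally have eq: "Cst (\<bar>c\<bar> / 2) * ((B + Cst s' * G)\<^sup>2 + (Cst w * theta r - B\<^sup>2) + (Cst w * theta r - G\<^sup>2))
        = Cst \<bar>c\<bar> * (Cst s' * (B * G) + Cst w * theta r)" .
      have "Cst c = Cst \<bar>c\<bar> * (Cst s' :: 'n rpoly)"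
        by (subst s'(1)) (rule Cst_mult)
      then show ?thesis
        unfolding eq single by (simp add: Cst_mult distrib_left mult.assoc)
    qed
    also have "sos \<dots>" using s by (intro sos_Cst_mult sos_add sos_power2) auto
    finally show "sos (Poly_Mapping.single \<alpha> c + Cst (\<bar>c\<bar> * (C * sqrt (fact (abs_expo \<alpha>)))) * theta r)"
      by (simp add: w_def)
  qed
qed

section \<open>A weighted coefficient norm\<close>

text \<open>The weight \<open>\<surd>(\<bar>\<alpha>\<bar>!)\<close> is what \<open>theta\<close> can absorb, since it is at least \<open>\<lceil>\<bar>\<alpha>\<bar> / 2\<rceil>!\<close>, and yet
  entire functions of exponential type have finite norm for every dilation \<open>\<rho>\<close>. The norms
  are submultiplicative only up to doubling \<open>\<rho>\<close>, so that convergence means convergence for all \<open>\<rho>\<close>.\<close>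

definition wnorm :: "real \<Rightarrow> 'n::finite rpoly \<Rightarrow> real"
  where "wnorm \<rho> p = (\<Sum>\<alpha>\<in>Poly_Mapping.keys p.
    \<bar>Poly_Mapping.lookup p \<alpha>\<bar> * (\<rho> ^ abs_expo \<alpha> * sqrt (fact (abs_expo \<alpha>))))"

lemma wnorm_superset:
  "finite K \<Longrightarrow> Poly_Mapping.keys p \<subseteq> K \<Longrightarrow>
    wnorm \<rho> p = (\<Sum>\<alpha>\<in>K. \<bar>Poly_Mapping.lookup p \<alpha>\<bar> * (\<rho> ^ abs_expo \<alpha> * sqrt (fact (abs_expo \<alpha>))))"
  unfolding wnorm_def by (rule sum.mono_neutral_left) (auto simp: in_keys_iff)

lemma wnorm_nonneg: "\<rho> \<ge> 0 \<Longrightarrow> wnorm \<rho> p \<ge> 0"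
  unfolding wnorm_def by (intro sum_nonneg mult_nonneg_nonneg) auto

lemma wnorm_0 [simp]: "wnorm \<rho> 0 = 0"
  by (simp add: wnorm_def)

lemma wnorm_single: "wnorm \<rho> (Poly_Mapping.single \<alpha> c) = \<bar>c\<bar> * (\<rho> ^ abs_expo \<alpha> * sqrt (fact (abs_expo \<alpha>)))"
  by (simp add: wnorm_def)

lemma wnorm_Cst_mult: "wnorm \<rho> (Cst c * p) = \<bar>c\<bar> * wnorm \<rho> p"
proof -
  have "Poly_Mapping.lookup (Cst c * p) \<alpha> = c * Poly_Mapping.lookup p \<alpha>" for \<alpha>
  proof -
    have "Cst c * p = Poly_Mapping.map ((*) c) p"
      by (simp add: Cst_def mult_map_scale_conv_mult)
    then show ?thesis by (simp add: Poly_Mapping.map.rep_eq when_def)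
  qed
  moreover from this have "Poly_Mapping.keys (Cst c * p) \<subseteq> Poly_Mapping.keys p"
    by (auto simp: in_keys_iff)
  ultimately show ?thesis
    by (simp add: wnorm_superset[of "Poly_Mapping.keys p"] sum_distrib_left abs_mult mult.assoc)
qed

lemma wnorm_uminus: "wnorm \<rho> (- p) = wnorm \<rho> p"
  by (simp add: wnorm_def in_keys_iff[abs_def] Poly_Mapping.keys.rep_eq)

lemma wnorm_add:
  assumes "\<rho> \<ge> 0"
  shows "wnorm \<rho> (p + q) \<le> wnorm \<rho> p + wnorm \<rho> q"
proof -
  define K where "K = Poly_Mapping.keys p \<union> Poly_Mapping.keys q"
  have "finite K" by (simp add: K_def)
  then show ?thesis
    using Poly_Mapping.keys_add[of p q] assms
    by (auto simp: wnorm_superset[of K] K_def lookup_add simp flip: sum.distrib distrib_right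
        intro!: sum_mono mult_right_mono abs_triangle_ineq)
qed

lemma wnorm_sum: "\<rho> \<ge> 0 \<Longrightarrow> wnorm \<rho> (sum h A) \<le> (\<Sum>a\<in>A. wnorm \<rho> (h a))"
proof (induction A rule: infinite_finite_induct)
  case (insert a A)
  then show ?case using wnorm_add[of \<rho> "h a" "sum h A"] by simp
qed simp_all

text \<open>The binomial coefficient is at most 2^(a+b). This factor is squared before the root is
  taken, so that an integral power remains, which doubling the dilation can absorb.\<close>

lemma sqrt_fact_add_le: "sqrt (fact (a + b)) \<le> 2 ^ (a + b) * (sqrt (fact a) * sqrt (fact b))"
proof -
  have "fact (a + b) = real ((a + b) choose a) * (fact a * fact b)"
    using binomial_fact_lemma[of a "a + b"]
    by (metis add_diff_cancel_left' le_add1 mult.commute of_nat_fact of_nat_mult)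
  also have "\<dots> \<le> 2 ^ (a + b) * (fact a * fact b)"
  proof (rule mult_right_mono)
    have "real ((a + b) choose a) \<le> real (2 ^ (a + b))"
      by (simp only: of_nat_le_iff binomial_le_pow2)
    then show "real ((a + b) choose a) \<le> 2 ^ (a + b)" by simp
  qed simp
  also have "\<dots> \<le> (2 ^ (a + b))\<^sup>2 * (fact a * fact b)"
    by (intro mult_right_mono self_le_power) auto
  finally have "sqrt (fact (a + b)) \<le> sqrt ((2 ^ (a + b))\<^sup>2 * (fact a * fact b))"
    by (rule real_sqrt_le_mono)
  then show ?thesis by (simp add: real_sqrt_mult)
qed

lemma wnorm_mult:
  assumes "\<rho> \<ge> 0"
  shows "wnorm \<rho> (p * q) \<le> wnorm (2 * \<rho>) p * wnorm (2 * \<rho>) q"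
proof -
  let ?w = "\<lambda>\<alpha>. (2 * \<rho>) ^ abs_expo \<alpha> * sqrt (fact (abs_expo \<alpha>))"
  let ?p = "Poly_Mapping.lookup p" and ?q = "Poly_Mapping.lookup q"
  have w: "\<rho> ^ abs_expo (\<alpha> + \<beta>) * sqrt (fact (abs_expo (\<alpha> + \<beta>))) \<le> ?w \<alpha> * ?w \<beta>" for \<alpha> \<beta> :: "'a expo"
    using mult_left_mono[OF sqrt_fact_add_le[of "abs_expo \<alpha>" "abs_expo \<beta>"], of "\<rho> ^ abs_expo (\<alpha> + \<beta>)"] assms
    by (simp add: abs_expo_add power_add power_mult_distrib algebra_simps)
  have "wnorm \<rho> (p * q) \<le> (\<Sum>\<alpha>\<in>Poly_Mapping.keys p. \<Sum>\<beta>\<in>Poly_Mapping.keys q.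
      wnorm \<rho> (Poly_Mapping.single (\<alpha> + \<beta>) (?p \<alpha> * ?q \<beta>)))"
    unfolding mult_expand by (intro order_trans[OF wnorm_sum] sum_mono wnorm_sum assms)
  also have "\<dots> \<le> (\<Sum>\<alpha>\<in>Poly_Mapping.keys p. \<Sum>\<beta>\<in>Poly_Mapping.keys q. \<bar>?p \<alpha> * ?q \<beta>\<bar> * (?w \<alpha> * ?w \<beta>))"
    unfolding wnorm_single by (intro sum_mono mult_left_mono w) auto
  also have "\<dots> = wnorm (2 * \<rho>) p * wnorm (2 * \<rho>) q"
    unfolding wnorm_def sum_product by (simp add: abs_mult algebra_simps)
  finally show ?thesis .
qed

text \<open>Summing the bounds for single monomials gives the norm with dilation 1. As
  \<open>C\<close> depends neither on p nor on r, the accuracy of an approximation can be prescribed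
  before its degree is known.\<close>

lemma sos_small_plus_theta:
  "\<exists>C>0. \<forall>(p :: 'n::finite rpoly) r \<delta>. deg p \<le> 2 * r \<longrightarrow> C * wnorm 1 p \<le> \<delta> \<longrightarrow> sos (p + Cst \<delta> * theta r)"
proof -
  obtain C where C: "C \<ge> 0" and mono: "\<And>(\<alpha> :: 'n expo) r c. abs_expo \<alpha> \<le> 2 * r \<Longrightarrow>
     sos (Poly_Mapping.single \<alpha> c + Cst (\<bar>c\<bar> * (C * sqrt (fact (abs_expo \<alpha>)))) * theta r)"
    using sos_monomial_plus_theta by blast
  show ?thesis
  \<comment> \<open>The monomial bound gives only \<open>C \<ge> 0\<close>; the shift makes the
    constant positive, so that an accuracy can be divided by it.\<close>
  proof (intro exI[of _ "C + 1"] conjI allI impI)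
    show "C + 1 > 0" using C by simp
  next
    fix p :: "'n rpoly" and r \<delta>
    assume deg: "deg p \<le> 2 * r" and le: "(C + 1) * wnorm 1 p \<le> \<delta>"
    let ?p = "Poly_Mapping.lookup p"
    have "sos (\<Sum>\<alpha>\<in>Poly_Mapping.keys p. Poly_Mapping.single \<alpha> (?p \<alpha>)
        + Cst (\<bar>?p \<alpha>\<bar> * (C * sqrt (fact (abs_expo \<alpha>)))) * theta r)"
      using deg by (intro sos_sum mono) (auto simp: deg_le_iff expos_def)
    also have "(\<Sum>\<alpha>\<in>Poly_Mapping.keys p. Poly_Mapping.single \<alpha> (?p \<alpha>)
        + Cst (\<bar>?p \<alpha>\<bar> * (C * sqrt (fact (abs_expo \<alpha>)))) * theta r) = p + Cst (C * wnorm 1 p) * theta r"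
    proof -
      have "Cst (C * wnorm 1 p) = (\<Sum>\<alpha>\<in>Poly_Mapping.keys p. Cst (\<bar>?p \<alpha>\<bar> * (C * sqrt (fact (abs_expo \<alpha>)))) :: 'n rpoly)"
        by (simp add: wnorm_def sum_distrib_left mult.left_commute flip: Cst_sum)
      then show ?thesis
        by (simp only: sum.distrib rpoly_expand[of p, symmetric] sum_distrib_right)
    qed
    finally have "sos (p + Cst (C * wnorm 1 p) * theta r)" .
    moreover have "sos (Cst (\<delta> - C * wnorm 1 p) * (theta r :: 'n rpoly))"
      using le wnorm_nonneg[of 1 p] by (intro sos_Cst_mult sos_theta) (simp add: algebra_simps)
    ultimately have "sos ((p + Cst (C * wnorm 1 p) * theta r) + Cst (\<delta> - C * wnorm 1 p) * theta r)"
      by (rule sos_add)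
    then show "sos (p + Cst \<delta> * theta r)" by (simp add: Cst_diff algebra_simps)
  qed
qed

section \<open>Asymptotic equality of families of polynomials\<close>

definition wbounded :: "'t filter \<Rightarrow> ('t \<Rightarrow> 'n::finite rpoly) \<Rightarrow> bool"
  where "wbounded F P \<longleftrightarrow> (\<forall>\<rho>\<ge>0. \<exists>B. \<forall>\<^sub>F t in F. wnorm \<rho> (P t) \<le> B)"

definition wnull :: "'t filter \<Rightarrow> ('t \<Rightarrow> 'n::finite rpoly) \<Rightarrow> bool"
  where "wnull F P \<longleftrightarrow> (\<forall>\<rho>\<ge>0. ((\<lambda>t. wnorm \<rho> (P t)) \<longlongrightarrow> 0) F)"

lemma wbounded_const: "wbounded F (\<lambda>_. p)"
  unfolding wbounded_def by (metis always_eventually order_refl)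

lemma wnull_imp_wbounded:
  assumes "wnull F P"
  shows "wbounded F P"
  unfolding wbounded_def
proof (intro allI impI exI[of _ 1])
  fix \<rho> :: real assume "\<rho> \<ge> 0"
  then have "((\<lambda>t. wnorm \<rho> (P t)) \<longlongrightarrow> 0) F"
    using assms by (simp add: wnull_def)
  from order_tendstoD(2)[OF this zero_less_one] show "\<forall>\<^sub>F t in F. wnorm \<rho> (P t) \<le> 1"
    by eventually_elim simp
qed

lemma wbounded_add:
  assumes "wbounded F P" "wbounded F Q"
  shows "wbounded F (\<lambda>t. P t + Q t)"
  unfolding wbounded_def
proof (intro allI impI)
  fix \<rho> :: real assume \<rho>: "\<rho> \<ge> 0"
  obtain A B where "\<forall>\<^sub>F t in F. wnorm \<rho> (P t) \<le> A" "\<forall>\<^sub>F t in F. wnorm \<rho> (Q t) \<le> B"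
    using assms \<rho> unfolding wbounded_def by blast
  then have "\<forall>\<^sub>F t in F. wnorm \<rho> (P t + Q t) \<le> A + B"
    by eventually_elim (use wnorm_add[OF \<rho>] in \<open>meson add_mono order_trans\<close>)
  then show "\<exists>B. \<forall>\<^sub>F t in F. wnorm \<rho> (P t + Q t) \<le> B" ..
qed

lemma wbounded_mult:
  assumes "wbounded F P" "wbounded F Q"
  shows "wbounded F (\<lambda>t. P t * Q t)"
  unfolding wbounded_def
proof (intro allI impI)
  fix \<rho> :: real assume \<rho>: "\<rho> \<ge> 0"
  then have \<rho>': "2 * \<rho> \<ge> 0" by simp
  obtain A B where "\<forall>\<^sub>F t in F. wnorm (2 * \<rho>) (P t) \<le> A" "\<forall>\<^sub>F t in F. wnorm (2 * \<rho>) (Q t) \<le> B"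
    using assms \<rho>' unfolding wbounded_def by blast
  then have "\<forall>\<^sub>F t in F. wnorm \<rho> (P t * Q t) \<le> A * B"
  proof eventually_elim
    case (elim t)
    have "wnorm (2 * \<rho>) (P t) * wnorm (2 * \<rho>) (Q t) \<le> A * B"
      using elim wnorm_nonneg[OF \<rho>', of "P t"] wnorm_nonneg[OF \<rho>', of "Q t"] by (intro mult_mono) auto
    then show ?case using wnorm_mult[OF \<rho>, of "P t" "Q t"] by simp
  qed
  then show "\<exists>B. \<forall>\<^sub>F t in F. wnorm \<rho> (P t * Q t) \<le> B" ..
qed

lemma wnull_add:
  assumes "wnull F P" "wnull F Q"
  shows "wnull F (\<lambda>t. P t + Q t)"
  unfolding wnull_def
proof (intro allI impI)
  fix \<rho> :: real assume \<rho>: "\<rho> \<ge> 0"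
  have "((\<lambda>t. wnorm \<rho> (P t) + wnorm \<rho> (Q t)) \<longlongrightarrow> 0) F"
    using assms \<rho> unfolding wnull_def by (intro tendsto_add_zero) auto
  then show "((\<lambda>t. wnorm \<rho> (P t + Q t)) \<longlongrightarrow> 0) F"
    by (rule tendsto_sandwich[OF _ _ tendsto_const, rotated -1])
      (auto intro!: always_eventually wnorm_nonneg wnorm_add \<rho>)
qed

lemma wnull_mult_wbounded:
  assumes "wnull F P" "wbounded F Q"
  shows "wnull F (\<lambda>t. P t * Q t)"
  unfolding wnull_def
proof (intro allI impI)
  fix \<rho> :: real assume \<rho>: "\<rho> \<ge> 0"
  then have \<rho>': "2 * \<rho> \<ge> 0" by simp
  obtain B where B: "\<forall>\<^sub>F t in F. wnorm (2 * \<rho>) (Q t) \<le> B"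
    using assms \<rho>' unfolding wbounded_def by blast
  have lim: "((\<lambda>t. wnorm (2 * \<rho>) (P t) * B) \<longlongrightarrow> 0) F"
    using assms(1) \<rho>' unfolding wnull_def by (intro tendsto_mult_left_zero) auto
  have "\<forall>\<^sub>F t in F. wnorm \<rho> (P t * Q t) \<le> wnorm (2 * \<rho>) (P t) * B"
    using B
  proof eventually_elim
    case (elim t)
    then show ?case
      using wnorm_mult[OF \<rho>, of "P t" "Q t"] mult_left_mono[OF elim wnorm_nonneg[OF \<rho>', of "P t"]]
      by linarith
  qed
  then show "((\<lambda>t. wnorm \<rho> (P t * Q t)) \<longlongrightarrow> 0) F"
    by (rule tendsto_sandwich[OF _ _ tendsto_const lim, rotated])
      (auto intro!: always_eventually wnorm_nonneg \<rho>)
qed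

text \<open>Boundedness of both sides is built in to make the relation compatible with products: PQ
  - P'Q' = (P - P') Q + (Q - Q') P' is null only because Q and P' are bounded.\<close>

definition weq :: "'t filter \<Rightarrow> ('t \<Rightarrow> 'n::finite rpoly) \<Rightarrow> ('t \<Rightarrow> 'n rpoly) \<Rightarrow> bool"
  where "weq F P Q \<longleftrightarrow> wbounded F P \<and> wbounded F Q \<and> wnull F (\<lambda>t. P t - Q t)"

lemma weqI:
  assumes "wbounded F Q" "wnull F (\<lambda>t. P t - Q t)"
  shows "weq F P Q"
  using wbounded_add[OF assms(1) wnull_imp_wbounded[OF assms(2)]] assms by (simp add: weq_def)

lemma weq_refl: "wbounded F P \<Longrightarrow> weq F P P"
  by (rule weqI) (simp_all add: wnull_def)

lemma weq_const: "weq F (\<lambda>_. p) (\<lambda>_. p)"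
  by (intro weq_refl wbounded_const)

lemma weq_add:
  assumes "weq F P P'" "weq F Q Q'"
  shows "weq F (\<lambda>t. P t + Q t) (\<lambda>t. P' t + Q' t)"
proof (rule weqI)
  show "wbounded F (\<lambda>t. P' t + Q' t)"
    using assms by (intro wbounded_add) (auto simp: weq_def)
  have "wnull F (\<lambda>t. (P t - P' t) + (Q t - Q' t))"
    using assms by (intro wnull_add) (auto simp: weq_def)
  then show "wnull F (\<lambda>t. P t + Q t - (P' t + Q' t))" by (simp add: algebra_simps)
qed

lemma weq_mult:
  assumes "weq F P P'" "weq F Q Q'"
  shows "weq F (\<lambda>t. P t * Q t) (\<lambda>t. P' t * Q' t)"
proof (rule weqI)
  show "wbounded F (\<lambda>t. P' t * Q' t)"
    using assms by (intro wbounded_mult) (auto simp: weq_def)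
  have "wnull F (\<lambda>t. (P t - P' t) * Q t + (Q t - Q' t) * P' t)"
    using assms by (intro wnull_add wnull_mult_wbounded) (auto simp: weq_def)
  then show "wnull F (\<lambda>t. P t * Q t - P' t * Q' t)" by (simp add: algebra_simps)
qed

lemma weq_sum: "(\<And>a. a \<in> A \<Longrightarrow> weq F (P a) (Q a)) \<Longrightarrow> weq F (\<lambda>t. \<Sum>a\<in>A. P a t) (\<lambda>t. \<Sum>a\<in>A. Q a t)"
  by (induction A rule: infinite_finite_induct) (simp_all add: weq_const weq_add)

lemma weq_prod: "(\<And>a. a \<in> A \<Longrightarrow> weq F (P a) (Q a)) \<Longrightarrow> weq F (\<lambda>t. \<Prod>a\<in>A. P a t) (\<lambda>t. \<Prod>a\<in>A. Q a t)"
  by (induction A rule: infinite_finite_induct) (simp_all add: weq_const weq_mult)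

lemma weq_power: "weq F P Q \<Longrightarrow> weq F (\<lambda>t. P t ^ k) (\<lambda>t. Q t ^ k)"
  by (induction k) (simp_all add: weq_const weq_mult)

section \<open>Truncated trigonometric substitution\<close>

text \<open>The index pairs by which a product of two truncated series exceeds the truncation of
  their Cauchy product.\<close>

definition pair_tail :: "nat \<Rightarrow> (nat \<times> nat) set"
  where "pair_tail M = {(j, k). j \<le> M \<and> k \<le> M \<and> M < j + k}"

lemma finite_pair_tail: "finite (pair_tail M)"
  by (rule finite_subset[of _ "{..M} \<times> {..M}"]) (auto simp: pair_tail_def)

lemma sum_product_pair_tail:
  fixes A B :: "nat \<Rightarrow> 'a::semiring_0"
  shows "(\<Sum>j\<le>M. A j) * (\<Sum>k\<le>M. B k)
    = (\<Sum>n\<le>M. \<Sum>j\<le>n. A j * B (n - j)) + (\<Sum>(j, k)\<in>pair_tail M. A j * B k)"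
proof -
  have fin: "finite {(j, k). j + k \<le> M}"
    by (rule finite_subset[of _ "{..M} \<times> {..M}"]) auto
  have "(\<Sum>j\<le>M. A j) * (\<Sum>k\<le>M. B k) = (\<Sum>(j, k)\<in>{..M} \<times> {..M}. A j * B k)"
    by (simp add: sum_product sum.cartesian_product)
  also have "{..M} \<times> {..M} = {(j, k). j + k \<le> M} \<union> pair_tail M"
    by (auto simp: pair_tail_def)
  also have "(\<Sum>(j, k)\<in>{(j, k). j + k \<le> M} \<union> pair_tail M. A j * B k)
      = (\<Sum>(j, k)\<in>{(j, k). j + k \<le> M}. A j * B k) + (\<Sum>(j, k)\<in>pair_tail M. A j * B k)"
    by (rule sum.union_disjoint) (auto simp: pair_tail_def finite_pair_tail[unfolded pair_tail_def] fin)
  also have "(\<Sum>(j, k)\<in>{(j, k). j + k \<le> M}. A j * B k) = (\<Sum>n\<le>M. \<Sum>j\<le>n. A j * B (n - j))"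
    by (rule sum.triangle_reindex_eq)
  finally show ?thesis .
qed

text \<open>The tail is the difference between the product of the partial sums and the partial sum
  of the Cauchy product; both tend to the square of the series.\<close>

lemma pair_tail_sum_tendsto_0:
  fixes h :: "nat \<Rightarrow> real"
  assumes "summable h" "\<And>k. h k \<ge> 0"
  shows "(\<lambda>M. \<Sum>(j, k)\<in>pair_tail M. h j * h k) \<longlonglongrightarrow> 0"
proof -
  have sn: "summable (\<lambda>k. norm (h k))" using assms by simp
  have "(\<lambda>M. (\<Sum>j\<le>M. h j) * (\<Sum>k\<le>M. h k)) \<longlonglongrightarrow> suminf h * suminf h"
    using summable_sums[OF assms(1)] unfolding sums_def_le by (intro tendsto_mult)
  moreover have "(\<lambda>M. \<Sum>n\<le>M. \<Sum>j\<le>n. h j * h (n - j)) \<longlonglongrightarrow> suminf h * suminf h"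
    using Cauchy_product_sums[OF sn sn] unfolding sums_def_le .
  ultimately have "(\<lambda>M. (\<Sum>j\<le>M. h j) * (\<Sum>k\<le>M. h k) - (\<Sum>n\<le>M. \<Sum>j\<le>n. h j * h (n - j)))
      \<longlonglongrightarrow> suminf h * suminf h - suminf h * suminf h"
    by (rule tendsto_diff)
  then show ?thesis by (simp add: sum_product_pair_tail)
qed

text \<open>A coefficient of size 1 / k! against the weight, the root of k!, leaves one over that
  root. The ratio of consecutive terms is x over the root of n + 1, at most 1/2 from n = (2x)^2
  on.\<close>

lemma summable_power_div_sqrt_fact:
  fixes x :: real
  assumes "x \<ge> 0"
  shows "summable (\<lambda>k. x ^ k / sqrt (fact k))"
proof (rule summable_ratio_test[where c = "1/2" and N = "nat \<lceil>(2 * x)\<^sup>2\<rceil>"])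
  fix n assume "n \<ge> nat \<lceil>(2 * x)\<^sup>2\<rceil>"
  then have "(2 * x)\<^sup>2 \<le> real (Suc n)" by linarith
  then have "2 * x \<le> sqrt (real (Suc n))" by (rule real_le_rsqrt)
  then have "x / sqrt (real (Suc n)) \<le> 1 / 2" by (simp add: field_simps)
  then have "x / sqrt (real (Suc n)) * (x ^ n / sqrt (fact n)) \<le> 1 / 2 * (x ^ n / sqrt (fact n))"
    using assms by (intro mult_right_mono) auto
  then show "norm (x ^ Suc n / sqrt (fact (Suc n))) \<le> 1 / 2 * norm (x ^ n / sqrt (fact n))"
    using assms by (simp add: real_sqrt_mult abs_mult)
qed simp

definition trunc :: "real fps \<Rightarrow> real \<Rightarrow> nat \<Rightarrow> 'n::finite \<Rightarrow> 'n rpoly"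
  where "trunc c a M i = (\<Sum>k\<le>M. Cst (fps_nth c k) * (Cst a * X i) ^ k)"

abbreviation "cosT \<equiv> trunc (fps_cos (1 / 2))"
abbreviation "sinT \<equiv> trunc (fps_sin (1 / 2))"

definition egf_bounded :: "real fps \<Rightarrow> bool"
  where "egf_bounded c \<longleftrightarrow> (\<forall>k. \<bar>fps_nth c k\<bar> \<le> 1 / fact k)"

lemma egf_bounded_cos: "egf_bounded (fps_cos (1 / 2))"
  and egf_bounded_sin: "egf_bounded (fps_sin (1 / 2))"
  unfolding egf_bounded_def
  by (auto simp: fps_cos_def fps_sin_def abs_mult power_divide field_simps)

lemma wnorm_term:
  assumes "\<rho> \<ge> 0" "a \<ge> 0" "\<bar>c\<bar> \<le> 1 / fact k"
  shows "wnorm \<rho> (Cst c * (Cst a * X i) ^ k) \<le> (a * \<rho>) ^ k / sqrt (fact k)"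
proof -
  have "Cst c * (Cst a * X i) ^ k = Poly_Mapping.single (Poly_Mapping.single i k) (c * a ^ k)"
    by (simp add: power_mult_distrib X_power Cst_mult_single flip: Cst_power)
  then have "wnorm \<rho> (Cst c * (Cst a * X i) ^ k) = \<bar>c\<bar> * ((a * \<rho>) ^ k * sqrt (fact k))"
    using assms by (simp add: wnorm_single abs_mult power_mult_distrib)
  also have "\<dots> \<le> 1 / fact k * ((a * \<rho>) ^ k * sqrt (fact k))"
    using assms by (intro mult_right_mono) auto
  also have "\<dots> = (a * \<rho>) ^ k / sqrt (fact k)"
  proof -
    have "fact k = sqrt (fact k) * sqrt (fact k :: real)" by simp
    then show ?thesis by (simp add: field_simps)
  qed
  finally show ?thesis .
qed

lemma wnorm_pair:
  assumes "\<rho> \<ge> 0" "a \<ge> 0" "egf_bounded c" "egf_bounded d"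
  shows "wnorm \<rho> ((Cst (fps_nth c j) * (Cst a * X i) ^ j) * (Cst (fps_nth d k) * (Cst a * X i) ^ k))
    \<le> (2 * a * \<rho>) ^ j / sqrt (fact j) * ((2 * a * \<rho>) ^ k / sqrt (fact k))"
proof -
  let ?f = "\<lambda>c j. Cst (fps_nth c j) * (Cst a * X i) ^ j"
  have le: "wnorm (2 * \<rho>) (?f c j) \<le> (2 * a * \<rho>) ^ j / sqrt (fact j)" if "egf_bounded c" for c j
    using wnorm_term[of "2 * \<rho>" a "fps_nth c j" j i] assms that
    by (simp add: egf_bounded_def algebra_simps)
  have "wnorm \<rho> (?f c j * ?f d k) \<le> wnorm (2 * \<rho>) (?f c j) * wnorm (2 * \<rho>) (?f d k)"
    by (rule wnorm_mult) fact
  also have "\<dots> \<le> (2 * a * \<rho>) ^ j / sqrt (fact j) * ((2 * a * \<rho>) ^ k / sqrt (fact k))"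
    using assms by (intro mult_mono le wnorm_nonneg) auto
  finally show ?thesis .
qed

lemma wnorm_pair_sum:
  assumes "\<rho> \<ge> 0" "a \<ge> 0" "egf_bounded c" "egf_bounded d"
  shows "wnorm \<rho> (\<Sum>(j, k)\<in>A. (Cst (fps_nth c j) * (Cst a * X i) ^ j) * (Cst (fps_nth d k) * (Cst a * X i) ^ k))
    \<le> (\<Sum>(j, k)\<in>A. (2 * a * \<rho>) ^ j / sqrt (fact j) * ((2 * a * \<rho>) ^ k / sqrt (fact k)))"
  by (rule order_trans[OF wnorm_sum[OF assms(1)]]) (intro sum_mono, simp only: case_prod_beta, rule wnorm_pair[OF assms])

lemma trunc_mult:
  "trunc c a M i * trunc d a M i =
    (\<Sum>n\<le>M. Cst (fps_nth (c * d) n) * (Cst a * X i) ^ n) +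
    (\<Sum>(j, k)\<in>pair_tail M. (Cst (fps_nth c j) * (Cst a * X i) ^ j) * (Cst (fps_nth d k) * (Cst a * X i) ^ k))"
proof -
  have "(\<Sum>j\<le>n. (Cst (fps_nth c j) * (Cst a * X i) ^ j) * (Cst (fps_nth d (n - j)) * (Cst a * X i) ^ (n - j)))
      = Cst (fps_nth (c * d) n) * (Cst a * X i) ^ n" for n
  proof -
    have "(\<Sum>j\<le>n. (Cst (fps_nth c j) * (Cst a * X i) ^ j) * (Cst (fps_nth d (n - j)) * (Cst a * X i) ^ (n - j)))
      = (\<Sum>j\<le>n. Cst (fps_nth c j * fps_nth d (n - j)) * ((Cst a * X i) ^ j * (Cst a * X i) ^ (n - j)))"
      by (simp add: Cst_mult algebra_simps)
    also have "\<dots> = (\<Sum>j\<le>n. Cst (fps_nth c j * fps_nth d (n - j)) * (Cst a * X i) ^ n)"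
      by (intro sum.cong refl) (simp flip: power_add)
    also have "\<dots> = Cst (fps_nth (c * d) n) * (Cst a * X i) ^ n"
      by (simp add: fps_mult_nth Cst_sum sum_distrib_right atMost_atLeast0)
    finally show ?thesis .
  qed
  then show ?thesis
    unfolding trunc_def by (simp add: sum_product_pair_tail)
qed

text \<open>The identity holds for the power series, so up to order M everything cancels and only
  the tails of the two squares remain.\<close>

lemma cos_sin_trunc_tendsto:
  assumes "a \<ge> 0"
  shows "weq sequentially (\<lambda>M. (cosT a M i)\<^sup>2 + (sinT a M i)\<^sup>2) (\<lambda>_. 1)"
proof (rule weqI[OF wbounded_const])
  let ?T = "\<lambda>c M. \<Sum>(j, k)\<in>pair_tail M. (Cst (fps_nth c j) * (Cst a * X i) ^ j) * (Cst (fps_nth c k) * (Cst a * X i) ^ k)"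
  have eq: "(cosT a M i)\<^sup>2 + (sinT a M i)\<^sup>2 - 1 = ?T (fps_cos (1/2)) M + ?T (fps_sin (1/2)) M" for M
  proof -
    have "(\<Sum>n\<le>M. Cst (fps_nth (fps_cos (1/2) * fps_cos (1/2)) n) * (Cst a * X i) ^ n)
        + (\<Sum>n\<le>M. Cst (fps_nth (fps_sin (1/2) * fps_sin (1/2)) n) * (Cst a * X i) ^ n)
        = (\<Sum>n\<le>M. Cst (fps_nth ((fps_cos (1/2))\<^sup>2 + (fps_sin (1/2))\<^sup>2) n) * (Cst a * X i) ^ n)"
      by (simp add: power2_eq_square Cst_add sum.distrib distrib_right)
    also have "\<dots> = (\<Sum>n\<le>M. if n = 0 then 1 else 0)"
      unfolding fps_sin_cos_sum_of_squares by (intro sum.cong) auto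
    also have "\<dots> = 1" by simp
    finally have "(\<Sum>n\<le>M. Cst (fps_nth (fps_cos (1/2) * fps_cos (1/2)) n) * (Cst a * X i) ^ n)
        + (\<Sum>n\<le>M. Cst (fps_nth (fps_sin (1/2) * fps_sin (1/2)) n) * (Cst a * X i) ^ n) = 1" .
    moreover have "A + P + (B + Q) - 1 = P + Q" if "A + B = 1" for A B P Q :: "'a rpoly"
      using that by (simp add: algebra_simps)
    ultimately show ?thesis unfolding power2_eq_square trunc_mult by blast
  qed
  have null: "wnull sequentially (?T c)" if c: "egf_bounded c" for c
    unfolding wnull_def
  proof (intro allI impI)
    fix \<rho> :: real assume \<rho>: "\<rho> \<ge> 0"
    let ?h = "\<lambda>k. (2 * a * \<rho>) ^ k / sqrt (fact k)"
    have lim: "(\<lambda>M. \<Sum>(j, k)\<in>pair_tail M. ?h j * ?h k) \<longlonglongrightarrow> 0"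
      using assms \<rho> by (intro pair_tail_sum_tendsto_0 summable_power_div_sqrt_fact) auto
    have le: "wnorm \<rho> (?T c M) \<le> (\<Sum>(j, k)\<in>pair_tail M. ?h j * ?h k)" for M
      by (rule wnorm_pair_sum[OF \<rho> assms c c])
    show "(\<lambda>M. wnorm \<rho> (?T c M)) \<longlonglongrightarrow> 0"
    proof (rule tendsto_sandwich[OF _ _ tendsto_const lim])
      show "\<forall>\<^sub>F M in sequentially. 0 \<le> wnorm \<rho> (?T c M)"
        by (intro always_eventually allI wnorm_nonneg \<rho>)
      show "\<forall>\<^sub>F M in sequentially. wnorm \<rho> (?T c M) \<le> (\<Sum>(j, k)\<in>pair_tail M. ?h j * ?h k)"
        by (intro always_eventually allI le)
    qed
  qed
  show "wnull sequentially (\<lambda>M. (cosT a M i)\<^sup>2 + (sinT a M i)\<^sup>2 - 1)"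
    unfolding eq by (intro wnull_add null egf_bounded_cos egf_bounded_sin)
qed

text \<open>As a is at most 1, every term of joint order at least 3 yields a factor a^3. The rest is
  bounded by the full series, hence uniformly in the truncation order M.\<close>

lemma pair_sum_order3_le:
  fixes x a :: real
  assumes "x \<ge> 0" "0 \<le> a" "a \<le> 1"
  shows "(\<Sum>(j, k)\<in>{(j, k). j \<le> M \<and> k \<le> M \<and> 2 < j + k}.
      (a * x) ^ j / sqrt (fact j) * ((a * x) ^ k / sqrt (fact k)))
    \<le> a ^ 3 * (suminf (\<lambda>k. x ^ k / sqrt (fact k)))\<^sup>2"
proof -
  let ?h = "\<lambda>k. x ^ k / sqrt (fact k)"
  let ?A = "{(j, k). j \<le> M \<and> k \<le> M \<and> 2 < j + k}"
  have sub: "?A \<subseteq> {..M} \<times> {..M}" by auto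
  have "(\<Sum>(j, k)\<in>?A. (a * x) ^ j / sqrt (fact j) * ((a * x) ^ k / sqrt (fact k)))
      \<le> (\<Sum>(j, k)\<in>?A. a ^ 3 * (?h j * ?h k))"
  proof (rule sum_mono, clarify)
    fix j k :: nat assume "2 < j + k"
    then have "a ^ (j + k) \<le> a ^ 3" using assms by (intro power_decreasing) auto
    then have "a ^ (j + k) * (?h j * ?h k) \<le> a ^ 3 * (?h j * ?h k)"
      using assms by (intro mult_right_mono) auto
    then show "(a * x) ^ j / sqrt (fact j) * ((a * x) ^ k / sqrt (fact k)) \<le> a ^ 3 * (?h j * ?h k)"
      by (simp add: power_mult_distrib power_add algebra_simps)
  qed
  also have "\<dots> \<le> (\<Sum>(j, k)\<in>{..M} \<times> {..M}. a ^ 3 * (?h j * ?h k))"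
    using sub assms by (intro sum_mono2) auto
  also have "\<dots> = a ^ 3 * (\<Sum>k\<le>M. ?h k)\<^sup>2"
  proof -
    have "(\<Sum>k\<le>M. ?h k)\<^sup>2 = (\<Sum>(j, k)\<in>{..M} \<times> {..M}. ?h j * ?h k)"
      by (simp only: power2_eq_square sum_product sum.cartesian_product)
    then show ?thesis by (simp only: sum_distrib_left case_prod_unfold)
  qed
  also have "\<dots> \<le> a ^ 3 * (suminf ?h)\<^sup>2"
    using assms
    by (intro mult_left_mono power_mono sum_le_suminf summable_power_div_sqrt_fact sum_nonneg) auto
  finally show ?thesis .
qed

text \<open>The product is the double-angle formula for sin (a x). Its terms up to order 2 reduce to
  a x, and all of them are present as soon as M is at least 2; the remainder has order 3 in
  a.\<close>

lemma sin_trunc_near_id: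
  assumes "\<rho> \<ge> 0" "0 \<le> a" "a \<le> 1" "M \<ge> 2"
  shows "wnorm \<rho> (2 * cosT a M i * sinT a M i - Cst a * X i)
    \<le> 2 * a ^ 3 * (suminf (\<lambda>k. (2 * \<rho>) ^ k / sqrt (fact k)))\<^sup>2"
proof -
  let ?c = "\<lambda>j. Cst (fps_nth (fps_cos (1/2)) j) * (Cst a * X i) ^ j"
  let ?s = "\<lambda>j. Cst (fps_nth (fps_sin (1/2)) j) * (Cst a * X i) ^ j"
  let ?A = "{(j, k). j \<le> M \<and> k \<le> M \<and> 2 < j + k}"
  have finA: "finite ?A" by (rule finite_subset[of _ "{..M} \<times> {..M}"]) auto
  have fin2: "finite {(j :: nat, k). j + k \<le> 2}" by (rule finite_subset[of _ "{..2} \<times> {..2}"]) auto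
  have "cosT a M i * sinT a M i = (\<Sum>(j, k)\<in>{..M} \<times> {..M}. ?c j * ?s k)"
    by (simp add: trunc_def sum_product sum.cartesian_product)
  also have "{..M} \<times> {..M} = {(j, k). j + k \<le> 2} \<union> ?A"
    using assms(4) by auto
  also have "(\<Sum>(j, k)\<in>{(j, k). j + k \<le> 2} \<union> ?A. ?c j * ?s k)
      = (\<Sum>(j, k)\<in>{(j, k). j + k \<le> 2}. ?c j * ?s k) + (\<Sum>(j, k)\<in>?A. ?c j * ?s k)"
    by (rule sum.union_disjoint[OF fin2 finA]) auto
  also have "(\<Sum>(j, k)\<in>{(j, k). j + k \<le> 2}. ?c j * ?s k) = (\<Sum>n\<le>2. \<Sum>j\<le>n. ?c j * ?s (n - j))"
    by (rule sum.triangle_reindex_eq)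
  \<comment> \<open>Only the constant term of the cosine times the linear term of the sine survives:
    the cosine has no linear term, the sine no constant and no quadratic one.\<close>
  also have "\<dots> = Cst (1 / 2) * (Cst a * X i)"
    by (simp add: numeral_2_eq_2 fps_sin_def fps_cos_def)
  finally have "2 * cosT a M i * sinT a M i - Cst a * X i
      = (2 * Cst (1 / 2)) * (Cst a * X i) - Cst a * X i + Cst 2 * (\<Sum>(j, k)\<in>?A. ?c j * ?s k)"
    by (simp add: algebra_simps Cst_numeral)
  also have "2 * Cst (1 / 2) = (1 :: 'a rpoly)"
    by (simp flip: Cst_mult Cst_numeral)
  finally have eq: "wnorm \<rho> (2 * cosT a M i * sinT a M i - Cst a * X i) = 2 * wnorm \<rho> (\<Sum>(j, k)\<in>?A. ?c j * ?s k)"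
    by (simp add: wnorm_Cst_mult)
  have "wnorm \<rho> (\<Sum>(j, k)\<in>?A. ?c j * ?s k)
      \<le> (\<Sum>(j, k)\<in>?A. (2 * a * \<rho>) ^ j / sqrt (fact j) * ((2 * a * \<rho>) ^ k / sqrt (fact k)))"
    using assms by (intro wnorm_pair_sum egf_bounded_cos egf_bounded_sin)
  also have "\<dots> \<le> a ^ 3 * (suminf (\<lambda>k. (2 * \<rho>) ^ k / sqrt (fact k)))\<^sup>2"
    using pair_sum_order3_le[of "2 * \<rho>" a M] assms by (simp add: mult.left_commute mult.assoc)
  finally show ?thesis unfolding eq by simp
qed

text \<open>A Taylor truncation of \<open>sin (a x\<^sub>i) / a\<close>.\<close>

definition sinc_subst :: "real \<Rightarrow> nat \<Rightarrow> 'n::finite \<Rightarrow> 'n rpoly"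
  where "sinc_subst a M i = Cst (1 / a) * (2 * cosT a M i * sinT a M i)"

lemma wnorm_sinc_subst:
  assumes "\<rho> \<ge> 0" "0 < a" "a \<le> 1" "M \<ge> 2"
  shows "wnorm \<rho> (sinc_subst a M i - X i) \<le> 2 * a\<^sup>2 * (suminf (\<lambda>k. (2 * \<rho>) ^ k / sqrt (fact k)))\<^sup>2"
proof -
  have "Cst (1 / a) * Cst a = (1 :: 'a rpoly)"
    using assms by (simp flip: Cst_mult)
  then have "sinc_subst a M i - X i = Cst (1 / a) * (2 * cosT a M i * sinT a M i - Cst a * X i)"
    by (simp add: sinc_subst_def right_diff_distrib flip: mult.assoc)
  then have "wnorm \<rho> (sinc_subst a M i - X i) = 1 / a * wnorm \<rho> (2 * cosT a M i * sinT a M i - Cst a * X i)"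
    using assms by (simp add: wnorm_Cst_mult)
  also have "\<dots> \<le> 1 / a * (2 * a ^ 3 * (suminf (\<lambda>k. (2 * \<rho>) ^ k / sqrt (fact k)))\<^sup>2)"
    using assms by (intro mult_left_mono sin_trunc_near_id) auto
  also have "\<dots> = 2 * a\<^sup>2 * (suminf (\<lambda>k. (2 * \<rho>) ^ k / sqrt (fact k)))\<^sup>2"
    using assms by (simp add: power2_eq_square power3_eq_cube)
  finally show ?thesis .
qed

text \<open>The factor \<open>principal {2..}\<close> makes the convergence uniform in the truncation order.\<close>

lemma sinc_subst_weq_X:
  "weq (sequentially \<times>\<^sub>F principal {2..}) (\<lambda>(l, M). sinc_subst (1 / real (Suc l)) M i) (\<lambda>_. X i)"
proof (rule weqI[OF wbounded_const])
  show "wnull (sequentially \<times>\<^sub>F principal {2..})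
      (\<lambda>t. (case t of (l, M) \<Rightarrow> sinc_subst (1 / real (Suc l)) M i) - X i)"
    unfolding wnull_def
  proof (intro allI impI)
    fix \<rho> :: real assume \<rho>: "\<rho> \<ge> 0"
    define K where "K = (suminf (\<lambda>k. (2 * \<rho>) ^ k / sqrt (fact k)))\<^sup>2"
    have "(\<lambda>l. 2 * (1 / real (Suc l))\<^sup>2 * K) \<longlonglongrightarrow> 2 * 0\<^sup>2 * K"
      by (intro tendsto_intros LIMSEQ_Suc lim_1_over_n)
    then have lim: "((\<lambda>t. 2 * (1 / real (Suc (fst t)))\<^sup>2 * K) \<longlongrightarrow> 0) (sequentially \<times>\<^sub>F principal {2::nat..})"
      by (auto intro: filterlim_compose[OF _ filterlim_fst])
    have le: "wnorm \<rho> (sinc_subst (1 / real (Suc l)) M i - X i) \<le> 2 * (1 / real (Suc l))\<^sup>2 * K"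
      if "M \<ge> 2" for l M
      using wnorm_sinc_subst[OF \<rho> _ _ that, of "1 / real (Suc l)"] unfolding K_def by simp
    have "\<forall>\<^sub>F t in sequentially \<times>\<^sub>F principal {2..}.
        wnorm \<rho> ((case t of (l, M) \<Rightarrow> sinc_subst (1 / real (Suc l)) M i) - X i) \<le> 2 * (1 / real (Suc (fst t)))\<^sup>2 * K"
      unfolding eventually_prod_filter eventually_principal
      by (rule exI[of _ "\<lambda>_. True"], rule exI[of _ "\<lambda>M. M \<ge> 2"]) (use le in auto)
    then show "((\<lambda>t. wnorm \<rho> ((case t of (l, M) \<Rightarrow> sinc_subst (1 / real (Suc l)) M i) - X i)) \<longlongrightarrow> 0)
        (sequentially \<times>\<^sub>F principal {2..})"
      by (rule tendsto_sandwich[OF _ _ tendsto_const lim, rotated])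
        (auto intro!: always_eventually wnorm_nonneg \<rho>)
  qed
qed

text \<open>For fixed a the substitution need not approach x_i. Boundedness in M suffices, because
  in this regime only cos^2 + sin^2 is exchanged for 1.\<close>

lemma wbounded_sinc_subst:
  assumes "0 < a" "a \<le> 1"
  shows "wbounded sequentially (\<lambda>M. sinc_subst a M i)"
proof -
  have "wbounded sequentially (\<lambda>M. sinc_subst a M i - X i)"
    unfolding wbounded_def
  proof (intro allI impI exI)
    fix \<rho> :: real assume "\<rho> \<ge> 0"
    then show "\<forall>\<^sub>F M in sequentially. wnorm \<rho> (sinc_subst a M i - X i) \<le> 2 * a\<^sup>2 * (suminf (\<lambda>k. (2 * \<rho>) ^ k / sqrt (fact k)))\<^sup>2"
      using assms by (intro eventually_sequentiallyI[of 2] wnorm_sinc_subst)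
  qed
  from wbounded_add[OF this wbounded_const[of _ "X i"]] show ?thesis by simp
qed

text \<open>Homogenizing to degree \<open>N\<close> in each variable absorbs the truncation error in \<open>cos\<^sup>2 + sin\<^sup>2 = 1\<close>:
  the homogenized Bernstein certificate below is then an exact identity.\<close>

definition homog_subst :: "'n::finite rpoly \<Rightarrow> nat \<Rightarrow> ('n \<Rightarrow> 'n rpoly) \<Rightarrow> ('n \<Rightarrow> 'n rpoly) \<Rightarrow> 'n rpoly"
  where "homog_subst p N u v = (\<Sum>\<alpha>\<in>Poly_Mapping.keys p. Cst (Poly_Mapping.lookup p \<alpha>) *
    (\<Prod>i\<in>UNIV. u i ^ Poly_Mapping.lookup \<alpha> i * v i ^ (N - Poly_Mapping.lookup \<alpha> i)))"

lemma homog_subst_X: "homog_subst p N X (\<lambda>_. 1) = p"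
  by (subst (2) rpoly_expand) (simp add: homog_subst_def single_eq_prod_X)

lemma homog_subst_weq:
  assumes "\<And>i. weq F (\<lambda>t. u t i) (\<lambda>t. u' t i)" "\<And>i. weq F (\<lambda>t. v t i) (\<lambda>t. v' t i)"
  shows "weq F (\<lambda>t. homog_subst p N (u t) (v t)) (\<lambda>t. homog_subst p N (u' t) (v' t))"
  unfolding homog_subst_def by (intro weq_sum weq_mult weq_prod weq_power weq_const assms)

text \<open>The order of the quantifiers is the point: a fixes the cube and hence the Bernstein
  degree N, and only then may M depend on N. So a is chosen with every \<open>v i\<close> equal to
  1, where N is invisible, and for all M at least 2 at once; afterwards M is raised until cos^2 +
  sin^2 may replace 1.\<close>

lemma approx_by_homog_subst:
  fixes p :: "'n::finite rpoly"
  assumes "\<delta> > 0"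
  shows "\<exists>a. 0 < a \<and> a \<le> 1 \<and> (\<forall>N. \<exists>M. wnorm 1 (p - homog_subst p N (sinc_subst a M)
    (\<lambda>i. (cosT a M i)\<^sup>2 + (sinT a M i)\<^sup>2)) < \<delta>)"
proof -
  let ?F = "sequentially \<times>\<^sub>F principal {2::nat..}"
  let ?u = "\<lambda>(l, M). sinc_subst (1 / real (Suc l)) M :: 'n \<Rightarrow> 'n rpoly"
  \<comment> \<open>The degree 0 stands for an arbitrary one, since all powers of the homogenizing
    factor 1 agree.\<close>
  have "weq ?F (\<lambda>t. homog_subst p 0 (?u t) (\<lambda>_. 1)) (\<lambda>_. homog_subst p 0 X (\<lambda>_. 1))"
    using sinc_subst_weq_X by (intro homog_subst_weq weq_const) (simp add: case_prod_unfold)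
  then have "wnull ?F (\<lambda>t. homog_subst p 0 (?u t) (\<lambda>_. 1) - p)"
    by (simp add: weq_def homog_subst_X)
  then have "((\<lambda>t. wnorm 1 (homog_subst p 0 (?u t) (\<lambda>_. 1) - p)) \<longlongrightarrow> 0) ?F"
    by (simp add: wnull_def)
  then have "\<forall>\<^sub>F t in ?F. wnorm 1 (homog_subst p 0 (?u t) (\<lambda>_. 1) - p) < \<delta> / 2"
    using assms by (intro order_tendstoD) auto
  from eventually_eventually_prod_filter1[OF this]
  have "\<forall>\<^sub>F l in sequentially. \<forall>M\<ge>2. wnorm 1 (homog_subst p 0 (?u (l, M)) (\<lambda>_. 1) - p) < \<delta> / 2"
    unfolding eventually_principal Ball_def atLeast_iff .
  then obtain l where l: "\<And>M. M \<ge> 2 \<Longrightarrow> wnorm 1 (homog_subst p 0 (?u (l, M)) (\<lambda>_. 1) - p) < \<delta> / 2"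
    using eventually_happens'[OF sequentially_bot] by blast
  define a where "a = 1 / real (Suc l)"
  have a: "0 < a" "a \<le> 1" by (auto simp: a_def)
  have "\<exists>M. wnorm 1 (p - homog_subst p N (sinc_subst a M) (\<lambda>i. (cosT a M i)\<^sup>2 + (sinT a M i)\<^sup>2)) < \<delta>" for N
  proof -
    let ?v = "\<lambda>M i. (cosT a M i)\<^sup>2 + (sinT a M i)\<^sup>2 :: 'n rpoly"
    have "weq sequentially (\<lambda>M. homog_subst p N (sinc_subst a M) (?v M))
        (\<lambda>M. homog_subst p N (sinc_subst a M) (\<lambda>_. 1))"
      using a by (intro homog_subst_weq weq_refl wbounded_sinc_subst cos_sin_trunc_tendsto) auto
    then have "(\<lambda>M. wnorm 1 (homog_subst p N (sinc_subst a M) (?v M) - homog_subst p N (sinc_subst a M) (\<lambda>_. 1))) \<longlonglongrightarrow> 0"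
      by (simp add: weq_def wnull_def)
    then have "\<forall>\<^sub>F M in sequentially. wnorm 1 (homog_subst p N (sinc_subst a M) (?v M) - homog_subst p N (sinc_subst a M) (\<lambda>_. 1)) < \<delta> / 2"
      using assms by (intro order_tendstoD) auto
    with eventually_ge_at_top[of 2] have "\<forall>\<^sub>F M in sequentially.
        wnorm 1 (p - homog_subst p N (sinc_subst a M) (?v M)) < \<delta>"
    proof eventually_elim
      case (elim M)
      let ?H = "homog_subst p N (sinc_subst a M) (?v M)" and ?H1 = "homog_subst p N (sinc_subst a M) (\<lambda>_. 1)"
      have H1: "?H1 = homog_subst p 0 (?u (l, M)) (\<lambda>_. 1)"
        by (simp add: homog_subst_def a_def)
      have "p - ?H = - ((?H - ?H1) + (?H1 - p))" by simp
      then have "wnorm 1 (p - ?H) = wnorm 1 ((?H - ?H1) + (?H1 - p))"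
        by (simp only: wnorm_uminus)
      also have "\<dots> \<le> wnorm 1 (?H - ?H1) + wnorm 1 (?H1 - p)"
        by (rule wnorm_add) simp
      also have "\<dots> < \<delta>" using l[of M] elim unfolding H1 by linarith
      finally show ?case .
    qed
    then show ?thesis using eventually_happens'[OF sequentially_bot] by blast
  qed
  with a show ?thesis by blast
qed

section \<open>Bernstein positivity certificates\<close>

text \<open>A quotient of falling factorials: the probability that i draws without replacement from
  N objects, k of them marked, all hit marked ones. With replacement it would be (k / N)^i. Real
  subtraction makes the product vanish for i > k.\<close>

definition fall_ratio :: "nat \<Rightarrow> nat \<Rightarrow> nat \<Rightarrow> real"
  where "fall_ratio i N k = (\<Prod>l<i. (real k - real l) / (real N - real l))"

lemma binomial_mult_fall_ratio:
  "i \<le> N \<Longrightarrow> k \<le> N \<Longrightarrow>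
    real (N choose k) * fall_ratio i N k = (if i \<le> k then real ((N - i) choose (k - i)) else 0)"
proof (induction i)
  case (Suc i)
  then have IH: "real (N choose k) * fall_ratio i N k = (if i \<le> k then real ((N - i) choose (k - i)) else 0)"
    by simp
  have step: "real (N choose k) * fall_ratio (Suc i) N k
      = (if i \<le> k then real ((N - i) choose (k - i)) else 0) * ((real k - real i) / (real N - real i))"
    unfolding IH[symmetric] by (simp add: fall_ratio_def)
  show ?case
  proof (cases "Suc i \<le> k")
    case True
    have "(k - i) * ((N - i) choose (k - i)) = (N - i) * ((N - i - 1) choose (k - i - 1))"
      using True by (intro times_binomial_minus1_eq) simp
    then have "(real k - real i) * real ((N - i) choose (k - i))
        = (real N - real i) * real ((N - Suc i) choose (k - Suc i))"
      using True Suc.prems by (simp flip: of_nat_diff of_nat_mult)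
    then show ?thesis
      using True Suc.prems unfolding step by (simp add: field_simps)
  next
    case False
    then show ?thesis unfolding step by (cases "i = k") auto
  qed
qed (simp add: fall_ratio_def)

text \<open>The two kinds of drawing differ in one factor by l (N - k) / ((N - l) N). The bound on
  2i keeps N - l above N / 2, which is the origin of the 2.\<close>

lemma fall_ratio_factor:
  assumes "l < i" "2 * i \<le> N" "k \<le> N"
  shows "\<bar>(real k - real l) / (real N - real l)\<bar> \<le> 1"
    and "\<bar>(real k - real l) / (real N - real l) - real k / real N\<bar> \<le> 2 * real i / real N"
proof -
  have pos: "real N - real l > 0" "real N > 0" using assms by auto
  have "\<bar>real k - real l\<bar> \<le> real N - real l" using assms by auto
  then show "\<bar>(real k - real l) / (real N - real l)\<bar> \<le> 1"
    using pos by (simp add: abs_divide)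
  have "(real k - real l) / (real N - real l) - real k / real N
      = - (real l * (real N - real k) / ((real N - real l) * real N))"
    using pos by (simp add: field_simps)
  then have "\<bar>(real k - real l) / (real N - real l) - real k / real N\<bar>
      = real l * (real N - real k) / ((real N - real l) * real N)"
    using pos assms by (simp add: abs_mult)
  also have "\<dots> \<le> real l * real N / ((real N / 2) * real N)"
    using assms pos by (intro frac_le mult_mono mult_nonneg_nonneg) auto
  also have "\<dots> = 2 * real l / real N" using pos by simp
  also have "\<dots> \<le> 2 * real i / real N" using assms by (intro divide_right_mono) auto
  finally show "\<bar>(real k - real l) / (real N - real l) - real k / real N\<bar> \<le> 2 * real i / real N" .
qed

lemma fall_ratio_bounds:
  assumes "2 * i \<le> N" "k \<le> N"
  shows "\<bar>fall_ratio i N k\<bar> \<le> 1"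
    and "\<bar>fall_ratio i N k - (real k / real N) ^ i\<bar> \<le> 2 * (real i)\<^sup>2 / real N"
proof -
  show "\<bar>fall_ratio i N k\<bar> \<le> 1"
    unfolding fall_ratio_def abs_prod using fall_ratio_factor(1)[OF _ assms] by (intro prod_le_1) auto
  have "norm ((\<Prod>l<i. (real k - real l) / (real N - real l)) - (\<Prod>l<i. real k / real N))
      \<le> (\<Sum>l<i. norm ((real k - real l) / (real N - real l) - real k / real N))"
    using fall_ratio_factor(1)[OF _ assms] assms by (intro norm_prod_diff) (auto simp: divide_le_eq_1)
  also have "\<dots> \<le> (\<Sum>l<i. 2 * real i / real N)"
    using fall_ratio_factor(2)[OF _ assms] by (intro sum_mono) auto
  finally show "\<bar>fall_ratio i N k - (real k / real N) ^ i\<bar> \<le> 2 * (real i)\<^sup>2 / real N"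
    by (simp add: fall_ratio_def power2_eq_square mult_ac)
qed

text \<open>Up to a factor \<open>N choose k\<close>, the coefficient of \<open>y\<^sup>k z\<^sup>N\<^sup>-\<^sup>k\<close> in \<open>(y - z)\<^sup>j (y + z)\<^sup>N\<^sup>-\<^sup>j\<close>, obtained by
  expanding \<open>y - z = 2 y - (y + z)\<close>; it is close to the value of \<open>t\<^sup>j\<close> at \<open>t = 2 k / N - 1\<close>.\<close>

definition bern :: "nat \<Rightarrow> nat \<Rightarrow> nat \<Rightarrow> real"
  where "bern j N k = (\<Sum>i\<le>j. real (j choose i) * 2 ^ i * (- 1) ^ (j - i) * fall_ratio i N k)"

lemma sum_binomial_pow2: "(\<Sum>i\<le>j. real (j choose i) * 2 ^ i) = 3 ^ j"
  using binomial_ring[of "2::real" 1 j] by simp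

text \<open>In the expansion of (2t - 1)^j the coefficients have absolute sum (2 + 1)^j, and each
  power of t is replaced at a cost of order 1 / N.\<close>

lemma bern_bounds:
  assumes "2 * j \<le> N" "k \<le> N"
  shows "\<bar>bern j N k\<bar> \<le> 3 ^ j"
    and "\<bar>bern j N k - (2 * (real k / real N) - 1) ^ j\<bar> \<le> 3 ^ j * (2 * (real j)\<^sup>2 / real N)"
proof -
  let ?c = "\<lambda>i. real (j choose i) * 2 ^ i * (- 1) ^ (j - i)"
  have c: "\<bar>?c i\<bar> = real (j choose i) * 2 ^ i" for i by (simp add: abs_mult power_abs)
  have "\<bar>bern j N k\<bar> \<le> (\<Sum>i\<le>j. \<bar>?c i * fall_ratio i N k\<bar>)"
    unfolding bern_def by (rule sum_abs)
  also have "\<dots> \<le> (\<Sum>i\<le>j. real (j choose i) * 2 ^ i)"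
  proof (rule sum_mono)
    fix i assume "i \<in> {..j}"
    then have "\<bar>fall_ratio i N k\<bar> \<le> 1" using assms by (intro fall_ratio_bounds) auto
    then show "\<bar>?c i * fall_ratio i N k\<bar> \<le> real (j choose i) * 2 ^ i"
      unfolding abs_mult[of "?c i"] c by (intro mult_left_le) auto
  qed
  finally show "\<bar>bern j N k\<bar> \<le> 3 ^ j" by (simp add: sum_binomial_pow2)
  have "(2 * (real k / real N) - 1) ^ j = (2 * (real k / real N) + - 1) ^ j" by simp
  also have "\<dots> = (\<Sum>i\<le>j. ?c i * (real k / real N) ^ i)"
    unfolding binomial_ring by (intro sum.cong refl) (simp only: power_mult_distrib mult_ac)
  finally have "bern j N k - (2 * (real k / real N) - 1) ^ j
      = (\<Sum>i\<le>j. ?c i * (fall_ratio i N k - (real k / real N) ^ i))"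
    by (simp add: bern_def sum_subtractf right_diff_distrib)
  then have "\<bar>bern j N k - (2 * (real k / real N) - 1) ^ j\<bar>
      \<le> (\<Sum>i\<le>j. \<bar>?c i * (fall_ratio i N k - (real k / real N) ^ i)\<bar>)"
    by (simp only: sum_abs)
  also have "\<dots> \<le> (\<Sum>i\<le>j. real (j choose i) * 2 ^ i * (2 * (real j)\<^sup>2 / real N))"
  proof (rule sum_mono)
    fix i assume i: "i \<in> {..j}"
    then have "\<bar>fall_ratio i N k - (real k / real N) ^ i\<bar> \<le> 2 * (real i)\<^sup>2 / real N"
      using assms by (intro fall_ratio_bounds) auto
    also have "\<dots> \<le> 2 * (real j)\<^sup>2 / real N"
      using i by (intro divide_right_mono mult_left_mono power_mono) auto
    finally show "\<bar>?c i * (fall_ratio i N k - (real k / real N) ^ i)\<bar>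
        \<le> real (j choose i) * 2 ^ i * (2 * (real j)\<^sup>2 / real N)"
      unfolding abs_mult[of "?c i"] c by (intro mult_left_mono) auto
  qed
  also have "\<dots> = 3 ^ j * (2 * (real j)\<^sup>2 / real N)"
    unfolding sum_distrib_right[symmetric] sum_binomial_pow2 ..
  finally show "\<bar>bern j N k - (2 * (real k / real N) - 1) ^ j\<bar> \<le> 3 ^ j * (2 * (real j)\<^sup>2 / real N)" .
qed

lemma Cst_of_nat: "Cst (real k) = of_nat k"
  by (simp add: Cst_def)

lemma power_mult_sum_power:
  fixes y z :: "'n rpoly"
  assumes "i \<le> N"
  shows "y ^ i * (y + z) ^ (N - i)
    = (\<Sum>k\<le>N. Cst (real (N choose k) * fall_ratio i N k) * (y ^ k * z ^ (N - k)))"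
proof -
  have "y ^ i * (y + z) ^ (N - i) = (\<Sum>l\<le>N - i. of_nat ((N - i) choose l) * (y ^ (l + i) * z ^ (N - i - l)))"
    by (simp add: binomial_ring sum_distrib_left power_add algebra_simps)
  also have "\<dots> = (\<Sum>k\<in>{i..N}. of_nat ((N - i) choose (k - i)) * (y ^ k * z ^ (N - k)))"
    by (rule sum.reindex_bij_witness[of _ "\<lambda>k. k - i" "\<lambda>l. l + i"]) (use assms in \<open>auto simp: add.commute\<close>)
  also have "\<dots> = (\<Sum>k\<in>{i..N}. Cst (real (N choose k) * fall_ratio i N k) * (y ^ k * z ^ (N - k)))"
    using assms by (intro sum.cong) (auto simp: binomial_mult_fall_ratio Cst_of_nat)
  also have "\<dots> = (\<Sum>k\<le>N. Cst (real (N choose k) * fall_ratio i N k) * (y ^ k * z ^ (N - k)))"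
    using assms by (intro sum.mono_neutral_left) (auto simp: binomial_mult_fall_ratio)
  finally show ?thesis .
qed

lemma diff_power_mult_sum_power:
  fixes y z :: "'n rpoly"
  assumes "j \<le> N"
  shows "(y - z) ^ j * (y + z) ^ (N - j)
    = (\<Sum>k\<le>N. Cst (real (N choose k) * bern j N k) * (y ^ k * z ^ (N - k)))"
proof -
  let ?c = "\<lambda>i. real (j choose i) * 2 ^ i * (- 1) ^ (j - i)"
  have "(y - z) ^ j = (2 * y + (- (y + z))) ^ j" by (simp add: algebra_simps)
  also have "\<dots> = (\<Sum>i\<le>j. of_nat (j choose i) * (2 * y) ^ i * (- (y + z)) ^ (j - i))"
    by (rule binomial_ring)
  also have "\<dots> = (\<Sum>i\<le>j. Cst (?c i) * (y ^ i * (y + z) ^ (j - i)))"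
  proof (intro sum.cong refl)
    fix i
    have "(- (y + z)) ^ (j - i) = Cst ((- 1) ^ (j - i)) * (y + z) ^ (j - i)"
      by (subst power_minus) (simp add: Cst_power Cst_uminus)
    moreover have "(2 * y) ^ i = Cst (2 ^ i) * y ^ i"
      by (simp only: power_mult_distrib Cst_power Cst_numeral)
    ultimately show "of_nat (j choose i) * (2 * y) ^ i * (- (y + z)) ^ (j - i) = Cst (?c i) * (y ^ i * (y + z) ^ (j - i))"
      by (simp only: Cst_mult Cst_of_nat mult_ac)
  qed
  finally have "(y - z) ^ j * (y + z) ^ (N - j)
      = (\<Sum>i\<le>j. Cst (?c i) * (y ^ i * ((y + z) ^ (j - i) * (y + z) ^ (N - j))))"
    by (simp only: sum_distrib_right mult.assoc)
  also have "\<dots> = (\<Sum>i\<le>j. Cst (?c i) * (y ^ i * (y + z) ^ (N - i)))"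
    using assms by (intro sum.cong refl) (simp flip: power_add)
  also have "\<dots> = (\<Sum>i\<le>j. \<Sum>k\<le>N. Cst (real (N choose k) * (?c i * fall_ratio i N k)) * (y ^ k * z ^ (N - k)))"
  proof (intro sum.cong refl)
    fix i assume "i \<in> {..j}"
    then have "i \<le> N" using assms by simp
    from power_mult_sum_power[OF this, of y z]
    show "Cst (?c i) * (y ^ i * (y + z) ^ (N - i))
        = (\<Sum>k\<le>N. Cst (real (N choose k) * (?c i * fall_ratio i N k)) * (y ^ k * z ^ (N - k)))"
      by (simp only:) (simp add: sum_distrib_left Cst_mult algebra_simps)
  qed
  also have "\<dots> = (\<Sum>k\<le>N. \<Sum>i\<le>j. Cst (real (N choose k) * (?c i * fall_ratio i N k)) * (y ^ k * z ^ (N - k)))"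
    by (rule sum.swap)
  also have "\<dots> = (\<Sum>k\<le>N. Cst (real (N choose k) * bern j N k) * (y ^ k * z ^ (N - k)))"
    unfolding bern_def sum_distrib_left Cst_sum sum_distrib_right ..
  finally show ?thesis .
qed

text \<open>Dividing the i-th factor by \<open>3 ^ \<alpha> i\<close> puts all factors into [-1, 1],
  where the difference of two products is at most the sum of the differences of the factors.\<close>

lemma bern_prod_near_eval:
  fixes \<kappa> :: "'n::finite \<Rightarrow> nat"
  assumes "\<And>i. 2 * \<alpha> i \<le> N" "\<And>i. \<kappa> i \<le> N"
  shows "\<bar>(\<Prod>i\<in>UNIV. bern (\<alpha> i) N (\<kappa> i)) - (\<Prod>i\<in>UNIV. (2 * (real (\<kappa> i) / real N) - 1) ^ \<alpha> i)\<bar>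
    \<le> (\<Prod>i\<in>UNIV. 3 ^ \<alpha> i) * (\<Sum>i\<in>UNIV. 2 * (real (\<alpha> i))\<^sup>2 / real N)"
proof -
  let ?b = "\<lambda>i. bern (\<alpha> i) N (\<kappa> i)" and ?e = "\<lambda>i. (2 * (real (\<kappa> i) / real N) - 1) ^ \<alpha> i"
  have e: "\<bar>?e i\<bar> \<le> 3 ^ \<alpha> i" for i
  proof -
    have "0 \<le> real (\<kappa> i) / real N" "real (\<kappa> i) / real N \<le> 1"
      using assms(2)[of i] by (auto simp: divide_le_eq_1)
    then have "\<bar>2 * (real (\<kappa> i) / real N) - 1\<bar> \<le> 3" by linarith
    then show ?thesis unfolding power_abs by (intro power_mono) auto
  qed
  have "norm ((\<Prod>i\<in>UNIV. ?b i / 3 ^ \<alpha> i) - (\<Prod>i\<in>UNIV. ?e i / 3 ^ \<alpha> i))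
      \<le> (\<Sum>i\<in>UNIV. norm (?b i / 3 ^ \<alpha> i - ?e i / 3 ^ \<alpha> i))"
    using bern_bounds(1)[OF assms] e by (intro norm_prod_diff) (auto simp: abs_divide divide_le_eq_1)
  also have "\<dots> \<le> (\<Sum>i\<in>UNIV. 2 * (real (\<alpha> i))\<^sup>2 / real N)"
  proof (rule sum_mono)
    fix i
    have "norm (?b i / 3 ^ \<alpha> i - ?e i / 3 ^ \<alpha> i) = \<bar>?b i - ?e i\<bar> / 3 ^ \<alpha> i"
      by (simp flip: diff_divide_distrib add: abs_divide)
    also have "\<dots> \<le> 3 ^ \<alpha> i * (2 * (real (\<alpha> i))\<^sup>2 / real N) / 3 ^ \<alpha> i"
      by (intro divide_right_mono bern_bounds assms) auto
    finally show "norm (?b i / 3 ^ \<alpha> i - ?e i / 3 ^ \<alpha> i) \<le> 2 * (real (\<alpha> i))\<^sup>2 / real N" by simp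
  qed
  finally have "(\<Prod>i\<in>UNIV. 3 ^ \<alpha> i) * \<bar>(\<Prod>i\<in>UNIV. ?b i / 3 ^ \<alpha> i) - (\<Prod>i\<in>UNIV. ?e i / 3 ^ \<alpha> i)\<bar>
      \<le> (\<Prod>i\<in>UNIV. 3 ^ \<alpha> i) * (\<Sum>i\<in>UNIV. 2 * (real (\<alpha> i))\<^sup>2 / real N)"
    by (intro mult_left_mono) (auto intro: prod_nonneg)
  moreover have "(\<Prod>i\<in>UNIV. 3 ^ \<alpha> i) * \<bar>(\<Prod>i\<in>UNIV. ?b i / 3 ^ \<alpha> i) - (\<Prod>i\<in>UNIV. ?e i / 3 ^ \<alpha> i)\<bar>
      = \<bar>(\<Prod>i\<in>UNIV. ?b i) - (\<Prod>i\<in>UNIV. ?e i)\<bar>"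
    by (simp add: prod_dividef prod_nonneg abs_divide flip: diff_divide_distrib)
  ultimately show ?thesis by simp
qed

text \<open>Multiplied out, the substitution combines products of powers of \<open>y i\<close> and
  \<open>z i\<close>. Up to binomials, the coefficients are close to values of p on a grid, and the
  lower bound c outweighs the error for large N. This N is chosen before y and z, which later depend
  on it through M.\<close>

lemma sos_homog_subst:
  fixes p :: "'n::finite rpoly"
  assumes "0 < a" "0 < c" "\<And>x. c \<le> eval p x"
  shows "\<exists>N. \<forall>y z. (\<forall>i. sos (y i)) \<longrightarrow> (\<forall>i. sos (z i)) \<longrightarrow>
    sos (homog_subst p N (\<lambda>i. Cst (1 / a) * (y i - z i)) (\<lambda>i. y i + z i))"
proof -
  let ?p = "Poly_Mapping.lookup p" and ?l = Poly_Mapping.lookup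
  define err where "err \<alpha> = (\<Prod>i\<in>UNIV. 3 ^ ?l \<alpha> i) * (\<Sum>i\<in>UNIV. 2 * (real (?l \<alpha> i))\<^sup>2)" for \<alpha> :: "'n expo"
  define K where "K = (\<Sum>\<alpha>\<in>Poly_Mapping.keys p. \<bar>?p \<alpha>\<bar> * (1 / a) ^ abs_expo \<alpha> * err \<alpha>)"
  have "K \<ge> 0" unfolding K_def err_def using assms(1)
    by (intro sum_nonneg mult_nonneg_nonneg prod_nonneg) auto
  \<comment> \<open>The first bound serves the estimates for \<open>bern\<close>, with
    \<open>Suc\<close> ensuring N > 0; the second pushes the total error K / N below c.\<close>
  define N where "N = max (Suc (2 * deg p)) (nat \<lceil>K / c\<rceil>)"
  have N: "2 * deg p \<le> N" "0 < N" "K / real N \<le> c"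
  proof -
    have "K / c \<le> real N" unfolding N_def by linarith
    moreover show "0 < N" by (simp add: N_def)
    ultimately show "K / real N \<le> c" using assms(2) by (simp add: field_simps)
  qed (simp add: N_def)
  have le_deg: "2 * ?l \<alpha> i \<le> N" "?l \<alpha> i \<le> N" if "\<alpha> \<in> Poly_Mapping.keys p" for \<alpha> i
    using abs_expo_le_deg[OF that] lookup_le_abs_expo[of \<alpha> i] N(1) by linarith+
  define b where "b \<kappa> = (\<Sum>\<alpha>\<in>Poly_Mapping.keys p. ?p \<alpha> * (1 / a) ^ abs_expo \<alpha> * (\<Prod>i\<in>UNIV. bern (?l \<alpha> i) N (\<kappa> i)))"
    for \<kappa> :: "'n \<Rightarrow> nat"
  have b: "b \<kappa> \<ge> 0" if \<kappa>: "\<And>i. \<kappa> i \<le> N" for \<kappa>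
  proof -
    \<comment> \<open>The grid point of the cube [-1/a, 1/a]^n that belongs to the index
      \<open>\<kappa>\<close>.\<close>
    define x :: "real ^ 'n" where "x = (\<chi> i. 1 / a * (2 * (real (\<kappa> i) / real N) - 1))"
    let ?e = "\<lambda>\<alpha>. \<Prod>i\<in>UNIV. (2 * (real (\<kappa> i) / real N) - 1) ^ ?l \<alpha> i"
    let ?b = "\<lambda>\<alpha>. \<Prod>i\<in>UNIV. bern (?l \<alpha> i) N (\<kappa> i)"
    have "(\<Prod>i\<in>UNIV. (x $ i) ^ ?l \<alpha> i) = (1 / a) ^ abs_expo \<alpha> * ?e \<alpha>" for \<alpha>
    proof -
      have "(\<Prod>i\<in>UNIV. (x $ i) ^ ?l \<alpha> i) = (\<Prod>i\<in>UNIV. (1 / a) ^ ?l \<alpha> i * (2 * (real (\<kappa> i) / real N) - 1) ^ ?l \<alpha> i)"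
        unfolding x_def by (simp only: vec_lambda_beta power_mult_distrib)
      then show ?thesis by (simp only: prod.distrib power_sum abs_expo_def)
    qed
    then have "eval p x = (\<Sum>\<alpha>\<in>Poly_Mapping.keys p. ?p \<alpha> * (1 / a) ^ abs_expo \<alpha> * ?e \<alpha>)"
      by (simp add: eval_def mult.assoc)
    then have "\<bar>b \<kappa> - eval p x\<bar> = \<bar>\<Sum>\<alpha>\<in>Poly_Mapping.keys p. ?p \<alpha> * (1 / a) ^ abs_expo \<alpha> * (?b \<alpha> - ?e \<alpha>)\<bar>"
      by (simp add: b_def sum_subtractf right_diff_distrib)
    also have "\<dots> \<le> (\<Sum>\<alpha>\<in>Poly_Mapping.keys p. \<bar>?p \<alpha> * (1 / a) ^ abs_expo \<alpha> * (?b \<alpha> - ?e \<alpha>)\<bar>)"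
      by (rule sum_abs)
    also have "\<dots> \<le> (\<Sum>\<alpha>\<in>Poly_Mapping.keys p. \<bar>?p \<alpha>\<bar> * (1 / a) ^ abs_expo \<alpha> * (err \<alpha> / real N))"
    proof (rule sum_mono)
      fix \<alpha> assume \<alpha>: "\<alpha> \<in> Poly_Mapping.keys p"
      have "err \<alpha> / real N = (\<Prod>i\<in>UNIV. 3 ^ ?l \<alpha> i) * (\<Sum>i\<in>UNIV. 2 * (real (?l \<alpha> i))\<^sup>2 / real N)"
        by (simp only: err_def times_divide_eq_right[symmetric] sum_divide_distrib)
      moreover have "\<bar>?b \<alpha> - ?e \<alpha>\<bar> \<le> (\<Prod>i\<in>UNIV. 3 ^ ?l \<alpha> i) * (\<Sum>i\<in>UNIV. 2 * (real (?l \<alpha> i))\<^sup>2 / real N)"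
        by (intro bern_prod_near_eval le_deg \<alpha> \<kappa>)
      ultimately have "\<bar>?b \<alpha> - ?e \<alpha>\<bar> \<le> err \<alpha> / real N" by (simp only:)
      then have "\<bar>?p \<alpha>\<bar> * (1 / a) ^ abs_expo \<alpha> * \<bar>?b \<alpha> - ?e \<alpha>\<bar> \<le> \<bar>?p \<alpha>\<bar> * (1 / a) ^ abs_expo \<alpha> * (err \<alpha> / real N)"
        using assms(1) by (intro mult_left_mono) auto
      then show "\<bar>?p \<alpha> * (1 / a) ^ abs_expo \<alpha> * (?b \<alpha> - ?e \<alpha>)\<bar> \<le> \<bar>?p \<alpha>\<bar> * (1 / a) ^ abs_expo \<alpha> * (err \<alpha> / real N)"
        using assms(1) by (simp add: abs_mult)
    qed
    also have "\<dots> = K / real N" by (simp add: K_def sum_divide_distrib)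
    finally show "b \<kappa> \<ge> 0" using assms(3)[of x] N(3) by linarith
  qed
  have "sos (homog_subst p N (\<lambda>i. Cst (1 / a) * (y i - z i)) (\<lambda>i. y i + z i))"
    if y: "\<And>i. sos (y i)" and z: "\<And>i. sos (z i)" for y z :: "'n \<Rightarrow> 'n rpoly"
  proof -
    let ?P = "PiE UNIV (\<lambda>_. {..N}) :: ('n \<Rightarrow> nat) set"
    let ?m = "\<lambda>\<kappa>. \<Prod>i\<in>UNIV. y i ^ \<kappa> i * z i ^ (N - \<kappa> i)"
    let ?C = "\<lambda>\<kappa>. \<Prod>i\<in>UNIV. real (N choose \<kappa> i)"
    have monomial: "Cst (?p \<alpha>) * (\<Prod>i\<in>UNIV. (Cst (1 / a) * (y i - z i)) ^ ?l \<alpha> i * (y i + z i) ^ (N - ?l \<alpha> i))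
      = (\<Sum>\<kappa>\<in>?P. Cst (?C \<kappa> * (?p \<alpha> * (1 / a) ^ abs_expo \<alpha> * (\<Prod>i\<in>UNIV. bern (?l \<alpha> i) N (\<kappa> i)))) * ?m \<kappa>)"
      if \<alpha>: "\<alpha> \<in> Poly_Mapping.keys p" for \<alpha>
    proof -
      have "(\<Prod>i\<in>UNIV. (Cst (1 / a) * (y i - z i)) ^ ?l \<alpha> i * (y i + z i) ^ (N - ?l \<alpha> i))
          = (\<Prod>i\<in>UNIV. Cst ((1 / a) ^ ?l \<alpha> i) * ((y i - z i) ^ ?l \<alpha> i * (y i + z i) ^ (N - ?l \<alpha> i)))"
        by (simp only: power_mult_distrib Cst_power mult.assoc)
      also have "\<dots> = Cst ((1 / a) ^ abs_expo \<alpha>) * (\<Prod>i\<in>UNIV. (y i - z i) ^ ?l \<alpha> i * (y i + z i) ^ (N - ?l \<alpha> i))"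
        by (simp only: prod.distrib power_sum abs_expo_def Cst_prod)
      also have "(\<Prod>i\<in>UNIV. (y i - z i) ^ ?l \<alpha> i * (y i + z i) ^ (N - ?l \<alpha> i))
          = (\<Prod>i\<in>UNIV. \<Sum>k\<le>N. Cst (real (N choose k) * bern (?l \<alpha> i) N k) * (y i ^ k * z i ^ (N - k)))"
        using le_deg[OF \<alpha>] by (intro prod.cong refl diff_power_mult_sum_power)
      also have "\<dots> = (\<Sum>\<kappa>\<in>?P. \<Prod>i\<in>UNIV. Cst (real (N choose \<kappa> i) * bern (?l \<alpha> i) N (\<kappa> i)) * (y i ^ \<kappa> i * z i ^ (N - \<kappa> i)))"
        by (rule prod_sum_PiE) auto
      also have "\<dots> = (\<Sum>\<kappa>\<in>?P. Cst (?C \<kappa> * (\<Prod>i\<in>UNIV. bern (?l \<alpha> i) N (\<kappa> i))) * ?m \<kappa>)"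
        by (simp only: prod.distrib Cst_prod Cst_mult)
      finally show ?thesis
        by (simp only: sum_distrib_left Cst_mult mult.assoc mult.left_commute)
    qed
    have "homog_subst p N (\<lambda>i. Cst (1 / a) * (y i - z i)) (\<lambda>i. y i + z i)
      = (\<Sum>\<alpha>\<in>Poly_Mapping.keys p. \<Sum>\<kappa>\<in>?P.
          Cst (?C \<kappa> * (?p \<alpha> * (1 / a) ^ abs_expo \<alpha> * (\<Prod>i\<in>UNIV. bern (?l \<alpha> i) N (\<kappa> i)))) * ?m \<kappa>)"
      unfolding homog_subst_def by (intro sum.cong refl monomial)
    \<comment> \<open>The binomials in \<open>?C \<kappa>\<close> do not depend on
      \<open>\<alpha>\<close>, so after the exchange the sum over \<open>\<alpha>\<close> is
      \<open>b \<kappa>\<close>.\<close>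
    also have "\<dots> = (\<Sum>\<kappa>\<in>?P. \<Sum>\<alpha>\<in>Poly_Mapping.keys p.
          Cst (?C \<kappa> * (?p \<alpha> * (1 / a) ^ abs_expo \<alpha> * (\<Prod>i\<in>UNIV. bern (?l \<alpha> i) N (\<kappa> i)))) * ?m \<kappa>)"
      by (rule sum.swap)
    also have "\<dots> = (\<Sum>\<kappa>\<in>?P. Cst (?C \<kappa> * b \<kappa>) * ?m \<kappa>)"
      unfolding b_def sum_distrib_left Cst_sum sum_distrib_right ..
    also have "sos \<dots>"
      using b y z by (intro sos_sum sos_Cst_mult sos_prod sos_mult sos_power mult_nonneg_nonneg prod_nonneg)
        (auto simp: PiE_def Pi_def)
    finally show ?thesis .
  qed
  then show ?thesis by blast
qed

lemma sos_dense:
  fixes p :: "'n::finite rpoly"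
  assumes "0 < c" "\<And>x. c \<le> eval p x" "0 < \<delta>"
  shows "\<exists>q. sos q \<and> wnorm 1 (p - q) < \<delta>"
proof -
  obtain a where a: "0 < a" and approx: "\<And>N. \<exists>M. wnorm 1 (p - homog_subst p N (sinc_subst a M)
      (\<lambda>i. (cosT a M i)\<^sup>2 + (sinT a M i)\<^sup>2)) < \<delta>"
    using approx_by_homog_subst[OF assms(3), of p] by blast
  obtain N where N: "\<And>y z. (\<And>i. sos (y i)) \<Longrightarrow> (\<And>i. sos (z i)) \<Longrightarrow>
      sos (homog_subst p N (\<lambda>i. Cst (1 / a) * (y i - z i)) (\<lambda>i. y i + z i))"
    using sos_homog_subst[OF a assms(1,2)] by blast
  obtain M where M: "wnorm 1 (p - homog_subst p N (sinc_subst a M) (\<lambda>i. (cosT a M i)\<^sup>2 + (sinT a M i)\<^sup>2)) < \<delta>"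
    using approx by blast
  \<comment> \<open>Truncated counterparts of (1 + sin (a x_i)) / 2 and, for \<open>?z\<close>, (1 -
    sin (a x_i)) / 2. The factor 1/2 makes their sum exactly cos^2 + sin^2 and their difference
    exactly 2 cos sin.\<close>
  let ?y = "\<lambda>i. Cst (1 / 2) * (cosT a M i + sinT a M i)\<^sup>2 :: 'n rpoly"
  let ?z = "\<lambda>i. Cst (1 / 2) * (cosT a M i - sinT a M i)\<^sup>2 :: 'n rpoly"
  have half: "Cst (1 / 2) * (2 * h) = h" for h :: "'n rpoly"
  proof -
    have "Cst (1 / 2) * 2 = (1 :: 'n rpoly)" by (simp flip: Cst_mult Cst_numeral)
    then show ?thesis by (simp flip: mult.assoc)
  qed
  have "?y i - ?z i = Cst (1 / 2) * (2 * (2 * cosT a M i * sinT a M i))" for i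
    by (simp add: power2_eq_square algebra_simps)
  moreover have "?y i + ?z i = Cst (1 / 2) * (2 * ((cosT a M i)\<^sup>2 + (sinT a M i)\<^sup>2))" for i
    by (simp add: power2_eq_square algebra_simps)
  ultimately have "(\<lambda>i. Cst (1 / a) * (?y i - ?z i)) = sinc_subst a M"
    and "(\<lambda>i. ?y i + ?z i) = (\<lambda>i. (cosT a M i)\<^sup>2 + (sinT a M i)\<^sup>2)"
    by (simp_all only: half sinc_subst_def fun_eq_iff simp_thms)
  moreover have "sos (homog_subst p N (\<lambda>i. Cst (1 / a) * (?y i - ?z i)) (\<lambda>i. ?y i + ?z i))"
    by (intro N sos_Cst_mult sos_power2) auto
  ultimately show ?thesis using M by auto
qed

section \<open>Penalization of the constraints\<close>

lemma abs_eval_le: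
  assumes "\<And>i. \<bar>x $ i\<bar> \<le> t" "1 \<le> t" "deg p \<le> D"
  shows "\<bar>eval p x\<bar> \<le> (\<Sum>\<alpha>\<in>Poly_Mapping.keys p. \<bar>Poly_Mapping.lookup p \<alpha>\<bar>) * t ^ D"
proof -
  have mon: "\<bar>\<Prod>i\<in>UNIV. (x $ i) ^ Poly_Mapping.lookup \<alpha> i\<bar> \<le> t ^ D" if "\<alpha> \<in> Poly_Mapping.keys p" for \<alpha>
  proof -
    have "\<bar>\<Prod>i\<in>UNIV. (x $ i) ^ Poly_Mapping.lookup \<alpha> i\<bar> \<le> (\<Prod>i\<in>UNIV. t ^ Poly_Mapping.lookup \<alpha> i)"
      unfolding abs_prod power_abs using assms(1) by (intro prod_mono) (auto intro: power_mono)
    also have "\<dots> = t ^ abs_expo \<alpha>" by (simp add: power_sum abs_expo_def)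
    also have "\<dots> \<le> t ^ D"
      using abs_expo_le_deg[OF that] assms(2,3) by (intro power_increasing) auto
    finally show ?thesis .
  qed
  have "\<bar>eval p x\<bar> \<le> (\<Sum>\<alpha>\<in>Poly_Mapping.keys p.
      \<bar>Poly_Mapping.lookup p \<alpha> * (\<Prod>i\<in>UNIV. (x $ i) ^ Poly_Mapping.lookup \<alpha> i)\<bar>)"
    unfolding eval_def by (rule sum_abs)
  also have "\<dots> \<le> (\<Sum>\<alpha>\<in>Poly_Mapping.keys p. \<bar>Poly_Mapping.lookup p \<alpha>\<bar> * t ^ D)"
    unfolding abs_mult by (intro sum_mono mult_left_mono mon) auto
  finally show ?thesis by (simp add: sum_distrib_right)
qed

lemma eval_theta_ge:
  fixes x :: "real ^ 'n::finite"
  shows "eval (theta r) x \<ge> 1"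
    and "eval (theta r) x \<ge> (x $ i) ^ (2 * r) / fact r"
proof -
  have summand: "(\<Sum>j\<in>UNIV. (x $ j) ^ (2 * k) / fact k) \<le> eval (theta r) x" if "k \<le> r" for k
    unfolding eval_theta using that
    by (intro member_le_sum[of k "{0..r}" "\<lambda>k. \<Sum>j\<in>UNIV. (x $ j) ^ (2 * k) / fact k"]) (auto intro!: sum_nonneg)
  have "(1::real) \<le> real (card (UNIV :: 'n set))"
    by (simp add: Suc_leI card_gt_0_iff)
  also have "\<dots> \<le> eval (theta r) x" using summand[of 0] by simp
  finally show "eval (theta r) x \<ge> 1" .
  have "(x $ i) ^ (2 * r) / fact r \<le> (\<Sum>j\<in>UNIV. (x $ j) ^ (2 * r) / fact r)"
    by (rule member_le_sum) auto
  then show "eval (theta r) x \<ge> (x $ i) ^ (2 * r) / fact r" using summand[of r] by simp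
qed

text \<open>With t the largest coordinate in absolute value and D = deg f, the polynomial grows at
  most like A t^D, while \<open>theta d\<close> for d = D + 1 contributes t^(2D+2) / d!.\<close>

lemma coercive:
  fixes f :: "'n::finite rpoly"
  assumes "e > 0"
  shows "\<exists>d T. \<forall>x. (\<exists>i. T < \<bar>x $ i\<bar>) \<longrightarrow> 1 \<le> eval f x - s + e * eval (theta d) x"
proof -
  define D where "D = deg f"
  define d where "d = Suc D"
  define A where "A = (\<Sum>\<alpha>\<in>Poly_Mapping.keys f. \<bar>Poly_Mapping.lookup f \<alpha>\<bar>) + \<bar>s\<bar>"
  \<comment> \<open>Chosen so that t^2 is at least (A + 1) d! / e for t beyond T. The summand 1
    keeps t at least 1, so that larger exponents give larger powers.\<close>
  define T where "T = 1 + (A + 1) * fact d / e"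
  have "A \<ge> 0" by (auto simp: A_def intro: add_nonneg_nonneg sum_nonneg)
  have "T \<ge> 1" using assms \<open>A \<ge> 0\<close> by (simp add: T_def)
  have "1 \<le> eval f x - s + e * eval (theta d) x" if i: "T < \<bar>x $ i\<bar>" for x i
  proof -
    define t where "t = Max (range (\<lambda>i. \<bar>x $ i\<bar>))"
    have "t \<in> range (\<lambda>i. \<bar>x $ i\<bar>)" unfolding t_def by (intro Max_in) auto
    then obtain i0 where i0: "t = \<bar>x $ i0\<bar>" by auto
    have le_t: "\<bar>x $ i\<bar> \<le> t" for i unfolding t_def by (intro Max_ge) auto
    have t: "1 \<le> t" "T \<le> t" using le_t[of i] i \<open>T \<ge> 1\<close> by linarith+
    then have tD: "1 \<le> t ^ D" by simp
    have "\<bar>eval f x\<bar> + \<bar>s\<bar> \<le> A * t ^ D"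
      using abs_eval_le[of x t f D] le_t t tD mult_left_mono[OF tD, of "\<bar>s\<bar>"]
      by (simp add: A_def D_def distrib_right)
    moreover have "(A + 1) * t ^ D \<le> e * eval (theta d) x"
    proof -
      have "(A + 1) * fact d / e \<le> T" by (simp add: T_def)
      also have "\<dots> \<le> t * t" using t mult_mono[of T t 1 t] by simp
      finally have "A + 1 \<le> e * (t * t) / fact d"
        using assms by (simp add: field_simps)
      then have "(A + 1) * t ^ D \<le> e * (t * t) / fact d * t ^ D"
        using tD by (intro mult_right_mono) auto
      also have "\<dots> \<le> e * (t * t) / fact d * (t ^ D * t ^ D)"
        using tD assms t by (intro mult_left_mono) auto
      also have "\<dots> = e * (t ^ (2 * d) / fact d)"
      proof -
        have "2 * d = Suc (Suc (D + D))" by (simp add: d_def)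
        then have "t ^ (2 * d) = t * t * (t ^ D * t ^ D)" by (simp add: power_add)
        then show ?thesis by simp
      qed
      also have "t ^ (2 * d) = (x $ i0) ^ (2 * d)" unfolding i0 by (simp add: power_mult)
      also have "e * ((x $ i0) ^ (2 * d) / fact d) \<le> e * eval (theta d) x"
        using assms by (intro mult_left_mono eval_theta_ge) auto
      finally show ?thesis .
    qed
    ultimately show ?thesis using tD by (simp add: distrib_right)
  qed
  then show ?thesis by blast
qed

text \<open>Only the compact set where F is at most c needs help. There G has a positive minimum,
  since a zero of G would force F above c, and the worst deficit divided by that minimum is a
  sufficient multiplier.\<close>

lemma penalty_positive:
  fixes F G :: "'a::metric_space \<Rightarrow> real"
  assumes B: "compact B" and cont: "continuous_on UNIV F" "continuous_on UNIV G"
    and G: "\<And>x. 0 \<le> G x" and zero: "\<And>x. G x = 0 \<Longrightarrow> c < F x"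
  shows "\<exists>l\<ge>0. \<forall>x\<in>B. c \<le> F x + l * G x"
proof -
  define K where "K = {x\<in>B. F x \<le> c}"
  have "closed {x. F x \<le> c}"
    by (rule closed_Collect_le[OF cont(1) continuous_on_const])
  moreover have "K = B \<inter> {x. F x \<le> c}" by (auto simp: K_def)
  ultimately have "compact K" using B by (simp add: compact_Int_closed)
  show ?thesis
  proof (cases "K = {}")
    case True
    then show ?thesis by (intro exI[of _ 0]) (force simp: K_def)
  next
    case False
    obtain u where u: "u \<in> K" "\<And>x. x \<in> K \<Longrightarrow> F u \<le> F x"
      using continuous_attains_inf[OF \<open>compact K\<close> False continuous_on_subset[OF cont(1)]] by auto
    obtain v where v: "v \<in> K" "\<And>x. x \<in> K \<Longrightarrow> G v \<le> G x"
      using continuous_attains_inf[OF \<open>compact K\<close> False continuous_on_subset[OF cont(2)]] by auto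
    have "G v \<noteq> 0" using zero[of v] v by (auto simp: K_def)
    then have "G v > 0" using G[of v] by simp
    define l where "l = (c - F u) / G v"
    have "l \<ge> 0" using u \<open>G v > 0\<close> by (simp add: l_def K_def)
    moreover have "c \<le> F x + l * G x" if "x \<in> B" for x
    proof (cases "x \<in> K")
      case True
      have "c - F u = l * G v" using \<open>G v > 0\<close> by (simp add: l_def)
      also have "\<dots> \<le> l * G x" using v True \<open>l \<ge> 0\<close> by (intro mult_left_mono) auto
      finally show ?thesis using u(2)[OF True] by simp
    next
      case False
      have "l * G x \<ge> 0" using \<open>l \<ge> 0\<close> G[of x] by simp
      then show ?thesis using False that by (simp add: K_def)
    qed
    ultimately show ?thesis by blast
  qed
qed

text \<open>As \<open>theta d\<close> is at least 1, F is at least e on the zero set, which leaves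
  room above e / 2 for the penalty argument inside a box. Outside the box coercivity gives 1, and
  the penalty can only add to it.\<close>

lemma penalized_positive:
  fixes f :: "'n::finite rpoly"
  assumes e: "e > 0" and min: "\<And>x. x \<in> zeros m g \<Longrightarrow> s \<le> eval f x"
  shows "\<exists>d. \<exists>l\<ge>0. \<exists>c>0. \<forall>x. c \<le> eval (f - Cst s + Cst e * theta d + Cst l * (\<Sum>j=1..m. (g j)\<^sup>2)) x"
proof -
  obtain d T where T: "\<And>x i. T < \<bar>x $ i\<bar> \<Longrightarrow> 1 \<le> eval f x - s + e * eval (theta d) x"
    using coercive[OF e, of f s] by blast
  let ?F = "\<lambda>x. eval f x - s + e * eval (theta d) x" and ?G = "\<lambda>x. \<Sum>j=1..m. (eval (g j) x)\<^sup>2"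
  let ?B = "cbox (\<chi> i. - T) (\<chi> i. T) :: (real ^ 'n) set"
  have "\<exists>l\<ge>0. \<forall>x\<in>?B. e / 2 \<le> ?F x + l * ?G x"
  proof (rule penalty_positive)
    fix x assume "?G x = 0"
    then have "x \<in> zeros m g" by (simp add: sum_nonneg_eq_0_iff zeros_def)
    then have "s \<le> eval f x" by (rule min)
    moreover have "e \<le> e * eval (theta d) x"
      using e eval_theta_ge(1)[of d x] by simp
    ultimately show "e / 2 < ?F x" using e by linarith
  qed (auto intro!: continuous_intros continuous_on_eval sum_nonneg compact_cbox)
  then obtain l where l: "l \<ge> 0" "\<And>x. x \<in> ?B \<Longrightarrow> e / 2 \<le> ?F x + l * ?G x" by blast
  have "min 1 (e / 2) \<le> ?F x + l * ?G x" for x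
  proof (cases "x \<in> ?B")
    case True
    then show ?thesis using l(2) unfolding min_le_iff_disj by blast
  next
    case False
    then have "\<not> (\<forall>i. \<bar>x $ i\<bar> \<le> T)" by (simp add: mem_box_cart abs_le_iff minus_le_iff conj_commute)
    then obtain i where "T < \<bar>x $ i\<bar>" by (meson not_le)
    from T[OF this] have "1 \<le> ?F x" .
    moreover have "l * ?G x \<ge> 0" using l by (intro mult_nonneg_nonneg sum_nonneg) auto
    ultimately show ?thesis by simp
  qed
  then have "min 1 (e / 2) \<le> eval (f - Cst s + Cst e * theta d + Cst l * (\<Sum>j=1..m. (g j)\<^sup>2)) x" for x
    by (simp add: eval_add eval_diff eval_mult eval_sum eval_power)
  moreover have "min 1 (e / 2) > 0" using e by simp
  ultimately show ?thesis using l(1) by blast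
qed

section \<open>Dual feasibility of the minimum and the chain of inequalities\<close>

lemma dual_feasible_large:
  fixes f :: "'n::finite rpoly"
  assumes \<epsilon>: "\<epsilon> > 0" and min: "\<And>x. x \<in> zeros m g \<Longrightarrow> s \<le> eval f x"
  shows "\<exists>r0. \<forall>r\<ge>r0. deg f \<le> 2 * r \<longrightarrow> (\<forall>j\<in>{1..m}. deg ((g j)\<^sup>2) \<le> 2 * r) \<longrightarrow>
    ereal s \<le> sup_Qdual f m g \<epsilon> r"
proof -
  obtain d l c where l: "l \<ge> 0" and c: "c > 0"
    and pos: "\<And>x. c \<le> eval (f - Cst s + Cst (\<epsilon> / 2) * theta d + Cst l * (\<Sum>j=1..m. (g j)\<^sup>2)) x"
    using penalized_positive[of "\<epsilon> / 2" m g s f] \<epsilon> min by auto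
  define p where "p = f - Cst s + Cst (\<epsilon> / 2) * theta d + Cst l * (\<Sum>j=1..m. (g j)\<^sup>2)"
  obtain C where C: "C > 0" and absorb: "\<And>(h :: 'n rpoly) r \<delta>. deg h \<le> 2 * r \<Longrightarrow> C * wnorm 1 h \<le> \<delta> \<Longrightarrow>
      sos (h + Cst \<delta> * theta r)"
    using sos_small_plus_theta by blast
  obtain R where R: "sos R" "wnorm 1 (p - R) < \<epsilon> / 2 / C"
    using sos_dense[OF c, of p "\<epsilon> / 2 / C"] pos \<epsilon> C by (auto simp: p_def)
  have "ereal s \<le> sup_Qdual f m g \<epsilon> r"
    if r: "max d (deg (p - R)) \<le> r" and f: "deg f \<le> 2 * r" and g: "\<And>j. j \<in> {1..m} \<Longrightarrow> deg ((g j)\<^sup>2) \<le> 2 * r" for r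
  proof -
    \<comment> \<open>R is a sum of squares by choice, the middle summand by absorption of the small
      error p - R, the last because \<open>theta\<close> grows by even powers. Together they turn
      the \<open>theta d\<close> hidden in p into the full perturbation.\<close>
    define q where "q = R + (p - R + Cst (\<epsilon> / 2) * theta r) + Cst (\<epsilon> / 2) * (theta r - theta d)"
    have "C * wnorm 1 (p - R) \<le> \<epsilon> / 2" using R(2) C by (simp add: field_simps)
    then have "sos q" unfolding q_def
      using r R \<epsilon> by (intro sos_add sos_Cst_mult sos_theta_diff absorb) auto
    have "Cst \<epsilon> = Cst (\<epsilon> / 2) + (Cst (\<epsilon> / 2) :: 'n rpoly)" by (simp flip: Cst_add)
    then have q: "q = perturb f \<epsilon> r - Cst s + (\<Sum>j=1..m. Cst l * (g j)\<^sup>2)"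
      by (simp add: q_def p_def perturb_def sum_distrib_left algebra_simps)
    \<comment> \<open>R has cancelled in the closed form of q, so only the degrees of f,
      \<open>theta r\<close> and the squared constraints count.\<close>
    have "deg q \<le> 2 * r"
      unfolding q using g
      by (intro deg_add_le deg_diff_le deg_perturb_le f deg_sum_le deg_Cst_mult_le) auto
    moreover have "perturb f \<epsilon> r - Cst s = q - (\<Sum>j=1..m. Cst (restrict (\<lambda>_. l) {1..m} j) * (g j)\<^sup>2)"
      by (simp add: q)
    ultimately have "(restrict (\<lambda>_. l) {1..m}, s, q) \<in> Qdual_feasible f m g \<epsilon> r"
      using \<open>sos q\<close> l by (auto simp: Qdual_feasible_def)
    then show ?thesis unfolding sup_Qdual_def by (rule SUP_upper2) simp
  qed
  then show ?thesis by blast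
qed

lemma eval_theta_le_exp: "eval (theta r) x \<le> (\<Sum>i\<in>UNIV. exp ((x $ i)\<^sup>2))"
proof -
  have "eval (theta r) x = (\<Sum>i\<in>UNIV. \<Sum>k=0..r. ((x $ i)\<^sup>2) ^ k / fact k)"
    unfolding eval_theta by (subst sum.swap) (simp add: power_mult)
  also have "\<dots> \<le> (\<Sum>i\<in>UNIV. exp ((x $ i)\<^sup>2))"
  proof (rule sum_mono)
    fix i
    have "(\<Sum>k=0..r. ((x $ i)\<^sup>2) ^ k /\<^sub>R fact k) \<le> exp ((x $ i)\<^sup>2)"
      unfolding exp_def by (intro sum_le_suminf summable_exp_generic) auto
    then show "(\<Sum>k=0..r. ((x $ i)\<^sup>2) ^ k / fact k) \<le> exp ((x $ i)\<^sup>2)"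
      by (simp add: divide_inverse mult.commute)
  qed
  finally show ?thesis .
qed

theorem theorem4p4:
  fixes f :: "'n::finite rpoly" and g :: "nat \<Rightarrow> 'n rpoly" and m :: nat
    and xstar :: "real ^ 'n" and \<epsilon> :: real
  assumes "xstar \<in> zeros m g"
    and "ereal (eval f xstar) = fstar f m g"
    and "\<epsilon> > 0"
  shows "\<exists>r0. \<forall>r\<ge>r0.
    deg f \<le> 2 * r \<and> (\<forall>j\<in>{1..m}. deg ((g j)\<^sup>2) \<le> 2 * r) \<and>
    fstar f m g \<le> sup_Qdual f m g \<epsilon> r \<and>
    sup_Qdual f m g \<epsilon> r \<le> inf_Q f m g \<epsilon> r \<and>
    inf_Q f m g \<epsilon> r \<le> fstar f m g + ereal (\<epsilon> * eval (theta r) xstar) \<and>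
    fstar f m g + ereal (\<epsilon> * eval (theta r) xstar)
      \<le> fstar f m g + ereal (\<epsilon> * (\<Sum>i\<in>UNIV. exp ((xstar $ i)\<^sup>2)))"
proof -
  have min: "eval f xstar \<le> eval f x" if "x \<in> zeros m g" for x
  proof -
    have "fstar f m g \<le> ereal (eval f x)" unfolding fstar_def by (rule INF_lower[OF that])
    then show ?thesis by (simp flip: assms(2))
  qed
  obtain r0 where r0: "\<And>r. r \<ge> r0 \<Longrightarrow> deg f \<le> 2 * r \<Longrightarrow> (\<forall>j\<in>{1..m}. deg ((g j)\<^sup>2) \<le> 2 * r) \<Longrightarrow>
      ereal (eval f xstar) \<le> sup_Qdual f m g \<epsilon> r"
    using dual_feasible_large[OF assms(3) min] by blast
  define r1 where "r1 = r0 + deg f + (\<Sum>j\<in>{1..m}. deg ((g j)\<^sup>2))"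
  show ?thesis
  proof (intro exI[of _ r1] allI impI)
    fix r assume r: "r \<ge> r1"
    then have f: "deg f \<le> 2 * r" by (simp add: r1_def)
    have g: "deg ((g j)\<^sup>2) \<le> 2 * r" if "j \<in> {1..m}" for j
    proof -
      have "deg ((g j)\<^sup>2) \<le> (\<Sum>j\<in>{1..m}. deg ((g j)\<^sup>2))"
        using that by (intro member_le_sum[of j "{1..m}" "\<lambda>j. deg ((g j)\<^sup>2)"]) auto
      then show ?thesis using r by (simp add: r1_def)
    qed
    have "inf_Q f m g \<epsilon> r \<le> ereal (eval (perturb f \<epsilon> r) xstar)"
      using assms(1) f g by (intro inf_Q_le_eval) auto
    then have "inf_Q f m g \<epsilon> r \<le> fstar f m g + ereal (\<epsilon> * eval (theta r) xstar)"
      by (simp add: perturb_def eval_add eval_mult flip: assms(2))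
    moreover have "fstar f m g + ereal (\<epsilon> * eval (theta r) xstar)
        \<le> fstar f m g + ereal (\<epsilon> * (\<Sum>i\<in>UNIV. exp ((xstar $ i)\<^sup>2)))"
      using assms(3) eval_theta_le_exp[of r xstar] by (intro add_left_mono) (simp add: mult_left_mono)
    moreover have "fstar f m g \<le> sup_Qdual f m g \<epsilon> r"
      using r0[of r] r f g by (simp add: r1_def flip: assms(2))
    ultimately show "deg f \<le> 2 * r \<and> (\<forall>j\<in>{1..m}. deg ((g j)\<^sup>2) \<le> 2 * r) \<and>
      fstar f m g \<le> sup_Qdual f m g \<epsilon> r \<and>
      sup_Qdual f m g \<epsilon> r \<le> inf_Q f m g \<epsilon> r \<and>
      inf_Q f m g \<epsilon> r \<le> fstar f m g + ereal (\<epsilon> * eval (theta r) xstar) \<and>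
      fstar f m g + ereal (\<epsilon> * eval (theta r) xstar)
        \<le> fstar f m g + ereal (\<epsilon> * (\<Sum>i\<in>UNIV. exp ((xstar $ i)\<^sup>2)))"
      using f g weak_duality by blast
  qed
qed

end
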